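(* Let $X\subset\mathbb{R}^2$ be a non-empty bounded convex domain and let $(X,d)$ be the corresponding $2$-dimensional Hilbert geometry. Then the asymptotic dimension of $(X,d)$ is equal to $2$.
   Context: Hilbert geometry: for a non-empty bounded convex domain (open set) $X\subset\mathbb{R}^n$, $n\ge 2$, and distinct $x,y\in X$, the line through $x$ and $y$ meets $\partial X=\overline X\setminus X$ in exactly two points $x',y'$, labelled so that $x',x,y,y'$ are in this order; set $d(x,y)=\log\frac{|xy'||yx'|}{|xx'||yy'|}$ ($|\cdot\,\cdot|$ is Euclidean distance) and $d(x,x)=0$. This is the Hilbert metric and $(X,d)$ is the ($n$-dimensional) Hilbert geometry. Asymptotic dimension: for a family $\mathcal{U}$ of subsets of a metric space, the $r$-multiplicity of $\mathcal{U}$ is the smallest number $k$ such that every closed $r$-ball intersects at most $k$ elements of $\mathcal{U}$. For a metric space $Y$, $\mathrm{asdim}(Y)\le m$ if for each $r>0$ there exists a uniformly bounded cover $\mathcal{U}$ of $Y$ (the diameters of its elements are bounded by a common constant) with $r$-multiplicity at most $m+1$. The asymptotic dimension of $Y$ is $m$ if $\mathrm{asdim}(Y)\le m$ holds but $\mathrm{asdim}(Y)\le m-1$ does not. *)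

theory Defs
  imports "HOL-Analysis.Analysis" "HOL-Library.Extended_Nat"
begin

section \<open>The Hilbert metric\<close>

text \<open>The point where the ray from \<open>x\<close> through \<open>y\<close> leaves \<open>X\<close>. It is meaningful only for distinct
  points of a bounded convex open set. In the notation \<open>x', x, y, y'\<close> (in this order on the line)
  one has \<open>y' = hilbert_end X x y\<close> and \<open>x' = hilbert_end X y x\<close>.\<close>

definition hilbert_end :: "'a::euclidean_space set \<Rightarrow> 'a \<Rightarrow> 'a \<Rightarrow> 'a" where
  "hilbert_end X x y = (THE z. z \<in> frontier X \<and> y \<in> open_segment x z)"

lemma hilbert_end_ex1:
  fixes X :: "'a::euclidean_space set"
  assumes "open X" "convex X" "bounded X" "x \<in> X" "y \<in> X" "x \<noteq> y"
  shows "\<exists>!z. z \<in> frontier X \<and> y \<in> open_segment x z"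
proof (rule ex_ex1I)
  have int: "interior X = X" and fr: "frontier X = closure X - X"
    using assms(1) by (auto simp: interior_open frontier_def)
  obtain d where d: "0 < d" "x + d *\<^sub>R (y - x) \<in> frontier X"
    using ray_to_frontier[of X x "y - x"] assms int by (metis right_minus_eq)
  have "d > 1"
  proof (rule ccontr)
    assume "\<not> d > 1"
    then have "(1 - d) *\<^sub>R x + d *\<^sub>R y \<in> X"
      using assms d(1) by (intro convexD) auto
    then show False
      using d(2) fr by (simp add: algebra_simps)
  qed
  define z where "z = x + d *\<^sub>R (y - x)"
  have "y = (1 - 1/d) *\<^sub>R x + (1/d) *\<^sub>R z"
    using d(1) by (simp add: z_def algebra_simps)
  moreover have "x \<noteq> z"
    using d assms fr z_def by auto
  ultimately have "y \<in> open_segment x z"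
    unfolding in_segment using \<open>d > 1\<close> by (intro conjI exI[of _ "1/d"]) auto
  then show "\<exists>z. z \<in> frontier X \<and> y \<in> open_segment x z"
    using d(2) z_def by blast
next
  have fr: "frontier X = closure X - interior X"
    by (simp add: frontier_def)
  have param: "\<exists>t>1. z = x + t *\<^sub>R (y - x)" if seg: "y \<in> open_segment x z" for z
  proof -
    obtain u where u: "0 < u" "u < 1" "y = (1 - u) *\<^sub>R x + u *\<^sub>R z"
      using seg unfolding in_segment by auto
    then have "y - x = u *\<^sub>R (z - x)" by (simp add: algebra_simps)
    then have "z = x + (1/u) *\<^sub>R (y - x)" using u(1) by simp
    then show ?thesis using u(1,2) by (intro exI[of _ "1/u"]) simp
  qed
  have aux: "\<not> s < t" if st: "1 < s" "x + s *\<^sub>R (y - x) \<in> frontier X" "x + t *\<^sub>R (y - x) \<in> frontier X"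
    for s t
  proof
    assume "s < t"
    have "x + s *\<^sub>R (y - x) = (1 - s/t) *\<^sub>R x + (s/t) *\<^sub>R (x + t *\<^sub>R (y - x))"
      using st(1) \<open>s < t\<close> by (simp add: algebra_simps)
    moreover have "x \<noteq> x + t *\<^sub>R (y - x)"
      using st(1) \<open>s < t\<close> assms(6) by simp
    ultimately have "x + s *\<^sub>R (y - x) \<in> open_segment x (x + t *\<^sub>R (y - x))"
      unfolding in_segment using st(1) \<open>s < t\<close> by (intro conjI exI[of _ "s/t"]) auto
    moreover have "open_segment x (x + t *\<^sub>R (y - x)) \<subseteq> interior X"
      using assms st(3) fr
      by (intro in_interior_closure_convex_segment) (auto simp: interior_open)
    ultimately show False using st(2) fr by blast
  qed
  fix z w
  assume z: "z \<in> frontier X \<and> y \<in> open_segment x z"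
    and w: "w \<in> frontier X \<and> y \<in> open_segment x w"
  obtain s t where "s > 1" "z = x + s *\<^sub>R (y - x)" "t > 1" "w = x + t *\<^sub>R (y - x)"
    using param z w by meson
  then show "z = w"
    using aux[of s t] aux[of t s] z w by (metis linorder_neqE)
qed

text \<open>The value \<open>0\<close> outside \<open>X\<close> is a convention, needed because \<^locale>\<open>Metric_space\<close> asks for
  nonnegativity and symmetry on the whole type.\<close>

definition hilbert_dist :: "'a::euclidean_space set \<Rightarrow> 'a \<Rightarrow> 'a \<Rightarrow> real" where
  "hilbert_dist X x y =
     (if x \<in> X \<and> y \<in> X \<and> x \<noteq> y then
        let x' = hilbert_end X y x; y' = hilbert_end X x y
        in ln ((dist x y' * dist y x') / (dist x x' * dist y y'))
      else 0)"


section \<open>Asymptotic dimension\<close>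

text \<open>A metric space is given by its carrier \<open>M\<close> and its distance function \<open>d\<close>, as in
  \<^locale>\<open>Metric_space\<close>. The multiplicity is \<open>\<infinity>\<close> (the infimum of the empty set) if no finite
  bound exists. The finiteness condition is needed because infinite sets have \<^const>\<open>card\<close> zero.\<close>

definition r_multiplicity :: "'a set \<Rightarrow> ('a \<Rightarrow> 'a \<Rightarrow> real) \<Rightarrow> real \<Rightarrow> 'a set set \<Rightarrow> enat" where
  "r_multiplicity M d r \<U> =
     Inf {enat k | k. \<forall>x\<in>M. finite {U\<in>\<U>. U \<inter> Metric_space.mcball M d x r \<noteq> {}} \<and>
                            card {U\<in>\<U>. U \<inter> Metric_space.mcball M d x r \<noteq> {}} \<le> k}"

definition uniformly_bounded :: "('a \<Rightarrow> 'a \<Rightarrow> real) \<Rightarrow> 'a set set \<Rightarrow> bool" where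
  "uniformly_bounded d \<U> \<longleftrightarrow> (\<exists>D. \<forall>U\<in>\<U>. \<forall>x\<in>U. \<forall>y\<in>U. d x y \<le> D)"

definition asdim_le :: "'a set \<Rightarrow> ('a \<Rightarrow> 'a \<Rightarrow> real) \<Rightarrow> nat \<Rightarrow> bool" where
  "asdim_le M d m \<longleftrightarrow>
     (\<forall>r>0. \<exists>\<U>. \<U> \<subseteq> Pow M \<and> \<Union>\<U> = M \<and> uniformly_bounded d \<U> \<and>
              r_multiplicity M d r \<U> \<le> enat (m + 1))"

text \<open>The case \<open>m = 0\<close> is separate because subtraction on \<^typ>\<open>nat\<close> truncates; no nonempty space has
  asymptotic dimension at most \<open>-1\<close>.\<close>

definition has_asdim :: "'a set \<Rightarrow> ('a \<Rightarrow> 'a \<Rightarrow> real) \<Rightarrow> nat \<Rightarrow> bool" where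
  "has_asdim M d m \<longleftrightarrow> asdim_le M d m \<and> (m = 0 \<or> \<not> asdim_le M d (m - 1))"

end

theory Submission
  imports Defs
begin

text \<open>
  Write \<open>d\<close> for the Hilbert metric and \<open>K\<close> for the closure of \<open>X\<close>. The metric is the symmetrization
  \<open>d x y = F x y + F y x\<close> of the Funk metric \<open>F\<close>, and the bound \<open>F x y \<le> L\<close> says that
  \<open>c y - x\<close> lies in \<open>(c - 1) K\<close> with \<open>c = exp L\<close> (lemma \<open>funk_le_iff\<close>). This gives the triangle
  inequality. Since points on a segment share their exit points, segments are geodesic.

  \<^bold>\<open>Upper bound.\<close> If the diagonals of a quadrilateral cross, geodesic segments make the sum of two
  opposite sides at most the sum of the diagonals. Hence, on a strictly convex curve inside \<open>X\<close>, the
  graph that joins points at distance at most \<open>s\<close> is coarsely outerplanar: whenever two of its edges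
  cross as chords, some edge joins an end of one to an end of the other. In such a graph the connected
  components of every breadth-first sphere have diameter at most 13 (\<open>level_component_bounded\<close>): a
  vertex lying between two others of its component is near one of them, because a vertex slightly
  further up its geodesic to the root is separated by the component and by the two other geodesics.
  Colouring a vertex by the parity of its level shows that the curve has asymptotic dimension at most
  one, with bounds that depend on \<open>s\<close> alone.

  Let \<open>p\<close> be a base point of \<open>X\<close>. The function \<open>f = F p\<close> is 1-Lipschitz, and a band
  \<open>{a \<le> f < a + w}\<close> lies within a distance independent of \<open>a\<close> of one such curve (\<open>two_coloured_band\<close>).
  So every band has dimension at most one, uniformly. A Hurewicz-type argument over the line
  (\<open>asdim_le_2_bands\<close>) glues the bands to a space of dimension at most two.

  \<^bold>\<open>Lower bound.\<close> By Brouwer's theorem, if a cover of a triangle consists of sets none of which comes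
  near all three sides, then somewhere three of its members are close to one point
  (\<open>lebesgue_covering_triangle\<close>). So it is enough to map triangles into \<open>X\<close> such that no set of
  prescribed diameter meets all three sides. Choose three affinely independent extreme points of \<open>K\<close>
  and blow up their triangle radially towards the boundary. If points on the three sides stayed within
  a fixed distance of each other, their limits would lie in the boundary, and the segment between any
  two of them could be prolonged inside \<open>K\<close> beyond both ends. The limits would then coincide or lie in
  the relative interior of one boundary segment, which contains no extreme point; but they belong to the
  three boundary arcs between the chosen extreme points, so this is impossible (\<open>no_common_face\<close>,
  \<open>sides_far_apart\<close>).
\<close>

section \<open>The Funk metric\<close>

locale convex_domain =
  fixes X :: "'a::euclidean_space set"
  assumes open_X: "open X" and convex_X: "convex X" and bounded_X: "bounded X"
begin

lemma frontier_X: "frontier X = closure X - X"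
  using open_X by (simp add: frontier_def interior_open)

lemma hilbert_end:
  assumes "x \<in> X" "y \<in> X" "x \<noteq> y"
  shows "hilbert_end X x y \<in> frontier X" "y \<in> open_segment x (hilbert_end X x y)"
  using theI'[OF hilbert_end_ex1[OF open_X convex_X bounded_X assms]]
  by (auto simp: hilbert_end_def)

lemma hilbert_end_eqI:
  assumes "x \<in> X" "y \<in> X" "z \<in> frontier X" "y \<in> open_segment x z"
  shows "hilbert_end X x y = z"
proof -
  have "x \<noteq> y" using assms(4) by (auto simp: open_segment_def)
  from hilbert_end_ex1[OF open_X convex_X bounded_X assms(1,2) this] hilbert_end[OF assms(1,2) this] assms(3,4)
  show ?thesis by auto
qed

text \<open>The Funk metric of \<open>X\<close>: the logarithm of \<open>|x y'| / |y y'|\<close>, where \<open>y'\<close> is the exit point of the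
  ray from \<open>x\<close> through \<open>y\<close>. It satisfies the triangle inequality but is not symmetric.\<close>

definition funk :: "'a \<Rightarrow> 'a \<Rightarrow> real" where
  "funk x y = (if x = y then 0 else ln (dist x (hilbert_end X x y) / dist y (hilbert_end X x y)))"

lemma funk_self [simp]: "funk x x = 0"
  by (simp add: funk_def)

text \<open>With \<open>z\<close> the exit point and \<open>c = |x z| / |y z|\<close>, the point \<open>y\<close> divides the segment from \<open>x\<close> to
  \<open>z\<close> in the ratio \<open>c - 1\<close> to \<open>1\<close>; so \<open>z\<close> can be recovered from \<open>funk x y\<close>.\<close>

lemma funk_ray:
  assumes "x \<in> X" "y \<in> X" "x \<noteq> y"
  shows "funk x y > 0"
    "hilbert_end X x y = y + (1 / (exp (funk x y) - 1)) *\<^sub>R (y - x)"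
proof -
  let ?z = "hilbert_end X x y"
  have seg: "y \<in> open_segment x ?z" using hilbert_end[OF assms] by auto
  then obtain u where u: "0 < u" "u < 1" "y = (1 - u) *\<^sub>R x + u *\<^sub>R ?z"
    unfolding in_segment by auto
  have "x \<noteq> ?z" using seg by auto
  have yz: "dist y ?z = (1 - u) * dist x ?z"
  proof -
    have "y - ?z = (1 - u) *\<^sub>R (x - ?z)" by (subst u(3)) (simp add: algebra_simps)
    then show ?thesis using u by (simp add: dist_norm)
  qed
  have r: "dist x ?z / dist y ?z = 1 / (1 - u)"
    using \<open>x \<noteq> ?z\<close> u by (simp add: yz)
  have e: "exp (funk x y) = 1 / (1 - u)"
    using assms u by (simp add: funk_def r)
  moreover have "1 < 1 / (1 - u)" using u by simp
  ultimately have "exp 0 < exp (funk x y)" by simp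
  then show "funk x y > 0" by (simp only: exp_less_cancel_iff)
  have "1 / (exp (funk x y) - 1) * u = 1 - u"
    using u by (simp add: e field_simps)
  moreover have "y - x = u *\<^sub>R (?z - x)" by (subst u(3)) (simp add: algebra_simps)
  ultimately have "(1 / (exp (funk x y) - 1)) *\<^sub>R (y - x) = (1 - u) *\<^sub>R (?z - x)"
    by simp
  also have "\<dots> = ?z - y" by (subst (3) u(3)) (simp add: algebra_simps)
  finally show "?z = y + (1 / (exp (funk x y) - 1)) *\<^sub>R (y - x)" by simp
qed

lemma funk_nonneg: "x \<in> X \<Longrightarrow> y \<in> X \<Longrightarrow> 0 \<le> funk x y"
  using funk_ray(1)[of x y] by (cases "x = y") auto

text \<open>The points \<open>y + s (y - x)\<close> belong to the closure of \<open>X\<close> exactly until the exit point is reached,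
  at \<open>s = 1 / (exp (funk x y) - 1)\<close>, and this value decreases in \<open>funk x y\<close>. The condition on the
  right is linear in \<open>x\<close> and \<open>y\<close> and is preserved under limits.\<close>

lemma funk_le_iff:
  assumes "x \<in> X" "y \<in> X" "L > 0"
  shows "funk x y \<le> L \<longleftrightarrow> y + (1 / (exp L - 1)) *\<^sub>R (y - x) \<in> closure X"
proof (cases "x = y")
  case True
  then show ?thesis using assms closure_subset[of X] by auto
next
  case False
  let ?F = "funk x y" and ?z = "hilbert_end X x y"
  define w where "w = y + (1 / (exp L - 1)) *\<^sub>R (y - x)"
  have F: "?F > 0" and z: "?z = y + (1 / (exp ?F - 1)) *\<^sub>R (y - x)"
    using funk_ray[OF assms(1,2) False] by auto
  have zf: "?z \<in> closure X" "?z \<notin> X" using hilbert_end[OF assms(1,2) False] frontier_X by auto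
  have y: "y \<in> X" "y \<in> closure X" using assms closure_subset by auto
  have eL: "exp L > 1" and eF: "exp ?F > 1" using assms F by auto
  show ?thesis
  proof
    assume "?F \<le> L"
    define t where "t = (exp ?F - 1) / (exp L - 1)"
    have t: "0 \<le> t" "t \<le> 1" using eL eF \<open>?F \<le> L\<close> by (auto simp: t_def)
    have "w = (1 - t) *\<^sub>R y + t *\<^sub>R ?z"
      using eF by (subst z) (simp add: w_def t_def algebra_simps)
    then have "w \<in> closure X"
      using y zf t convex_closure[OF convex_X] by (auto intro!: convexD)
    then show "y + (1 / (exp L - 1)) *\<^sub>R (y - x) \<in> closure X" by (simp add: w_def)
  next
    assume "y + (1 / (exp L - 1)) *\<^sub>R (y - x) \<in> closure X"
    then have w: "w \<in> closure X" by (simp add: w_def)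
    show "?F \<le> L"
    proof (rule ccontr)
      assume "\<not> ?F \<le> L"
      define t where "t = (exp L - 1) / (exp ?F - 1)"
      have t: "0 < t" "t < 1" using eL eF \<open>\<not> ?F \<le> L\<close> by (auto simp: t_def)
      have eq: "?z = (1 - t) *\<^sub>R y + t *\<^sub>R w"
        using eL by (subst z) (simp add: w_def t_def algebra_simps)
      have "w \<noteq> y" using False eL by (simp add: w_def)
      then have "?z \<in> open_segment y w" unfolding in_segment using t eq by auto
      moreover have "open_segment y w \<subseteq> interior X"
        using convex_X y w open_X by (intro in_interior_closure_convex_segment) (auto simp: interior_open)
      ultimately show False using zf interior_subset by blast
    qed
  qed
qed

lemma funk_triangle:
  assumes "x \<in> X" "y \<in> X" "z \<in> X"
  shows "funk x z \<le> funk x y + funk y z"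
proof (rule field_le_epsilon)
  fix e :: real assume "e > 0"
  define L M where "L = funk x y + e / 2" and "M = funk y z + e / 2"
  have pos: "L > 0" "M > 0" using funk_nonneg assms \<open>e > 0\<close> by (auto simp: L_def M_def intro: add_nonneg_pos)
  define p q where "p = y + (1 / (exp L - 1)) *\<^sub>R (y - x)" and "q = z + (1 / (exp M - 1)) *\<^sub>R (z - y)"
  have p: "p \<in> closure X" unfolding p_def
    using funk_le_iff[OF assms(1,2) pos(1)] \<open>e > 0\<close> by (simp add: L_def)
  have q: "q \<in> closure X" unfolding q_def
    using funk_le_iff[OF assms(2,3) pos(2)] \<open>e > 0\<close> by (simp add: M_def)
  \<comment> \<open>With \<open>c = exp L\<close> and \<open>c' = exp M\<close> the two memberships say that \<open>c y - x \<in> (c - 1) K\<close> and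
    \<open>c' z - y \<in> (c' - 1) K\<close>; adding \<open>c\<close> times the second to the first gives
    \<open>c c' z - x \<in> (c c' - 1) K\<close>.\<close>
  define c c' where "c = exp L" and "c' = exp M"
  have c: "c > 1" "c' > 1" using pos by (auto simp: c_def c'_def)
  have cc: "c * c' > 1" using c by (metis less_1_mult)
  define t where "t = (c - 1) / (c * c' - 1)"
  have "c \<le> c * c'" using c by simp
  then have t: "0 \<le> t" "t \<le> 1" using c cc by (auto simp: t_def divide_simps)
  have t1: "1 - t = c * (c' - 1) / (c * c' - 1)" using cc by (simp add: t_def field_simps)
  have P: "(c - 1) *\<^sub>R p = c *\<^sub>R y - x" using c by (simp add: p_def c_def[symmetric] algebra_simps)
  have Q: "(c' - 1) *\<^sub>R q = c' *\<^sub>R z - y" using c by (simp add: q_def c'_def[symmetric] algebra_simps)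
  have "(c * c' - 1) *\<^sub>R (t *\<^sub>R p + (1 - t) *\<^sub>R q) = (c - 1) *\<^sub>R p + c *\<^sub>R ((c' - 1) *\<^sub>R q)"
    using cc by (simp add: t1 scaleR_add_right) (simp add: t_def)
  also have "\<dots> = (c * c') *\<^sub>R z - x" unfolding P Q by (simp add: algebra_simps)
  also have "\<dots> = (c * c' - 1) *\<^sub>R (z + (1 / (c * c' - 1)) *\<^sub>R (z - x))"
    using cc by (simp add: algebra_simps)
  finally have eq: "t *\<^sub>R p + (1 - t) *\<^sub>R q = z + (1 / (c * c' - 1)) *\<^sub>R (z - x)"
    using cc by simp
  have "t *\<^sub>R p + (1 - t) *\<^sub>R q \<in> closure X"
    using t p q convex_closure[OF convex_X] by (intro convexD) auto
  then have "z + (1 / (exp (L + M) - 1)) *\<^sub>R (z - x) \<in> closure X"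
    by (simp add: eq exp_add c_def c'_def)
  then have "funk x z \<le> L + M" using funk_le_iff[OF assms(1,3)] pos by (simp add: add_pos_pos)
  then show "funk x z \<le> funk x y + funk y z + e" by (simp add: L_def M_def)
qed

text \<open>The rays from \<open>x\<close> through \<open>y\<close>, from \<open>x\<close> through \<open>z\<close>, and from \<open>z\<close> through \<open>y\<close> share their exit
  point, so the ratios telescope.\<close>

lemma funk_segment:
  assumes "x \<in> X" "y \<in> X" "z \<in> closed_segment x y"
  shows "funk x y = funk x z + funk z y"
proof (cases "z = x \<or> z = y")
  case True
  then show ?thesis by auto
next
  case False
  then have zo: "z \<in> open_segment x y" using assms(3) by (auto simp: open_segment_def)
  then have ne: "x \<noteq> y" by auto
  have zX: "z \<in> X" using assms convex_X by (meson closed_segment_subset in_mono)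
  let ?e = "hilbert_end X x y"
  have e: "?e \<in> frontier X" "y \<in> open_segment x ?e" using hilbert_end[OF assms(1,2) ne] by auto
  obtain u where u: "0 < u" "u < 1" "z = (1 - u) *\<^sub>R x + u *\<^sub>R y" "x \<noteq> y"
    using zo unfolding in_segment by auto
  obtain v where v: "0 < v" "v < 1" "y = (1 - v) *\<^sub>R x + v *\<^sub>R ?e" "x \<noteq> ?e"
    using e unfolding in_segment by auto
  have "u * v < v" using u v by simp
  moreover have "0 < u * v" using u v by simp
  ultimately have uv: "0 < u * v" "u * v < 1" "u * v < v" using v by linarith+
  have z1: "z = (1 - u * v) *\<^sub>R x + (u * v) *\<^sub>R ?e"
    unfolding u(3) by (subst v(3)) (simp add: algebra_simps)
  then have "z \<in> open_segment x ?e" using uv v(4) unfolding in_segment by blast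
  then have e1: "hilbert_end X x z = ?e" by (rule hilbert_end_eqI[OF assms(1) zX e(1)])
  define s where "s = (v - u * v) / (1 - u * v)"
  have s: "0 < s" "s < 1"
    using uv(2,3) v(2) by (simp_all add: s_def)
  have s1: "(1 - s) = (1 - v) / (1 - u * v)" using uv by (simp add: s_def field_simps)
  have s2: "(1 - s) * (1 - u * v) = 1 - v" using uv by (simp add: s1)
  have "(1 - s) *\<^sub>R z + s *\<^sub>R ?e = ((1 - s) * (1 - u * v)) *\<^sub>R x + ((1 - s) * (u * v) + s) *\<^sub>R ?e"
    by (subst z1) (simp add: scaleR_add_right scaleR_add_left)
  also note s2
  also have "(1 - s) * (u * v) + s = v" using s2 by (simp add: algebra_simps)
  also have "(1 - v) *\<^sub>R x + v *\<^sub>R ?e = y" by (rule v(3)[symmetric])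
  finally have "y = (1 - s) *\<^sub>R z + s *\<^sub>R ?e" by (rule sym)
  moreover have "z \<noteq> ?e" using zX e frontier_X by auto
  ultimately have "y \<in> open_segment z ?e" using s unfolding in_segment by blast
  then have e2: "hilbert_end X z y = ?e" by (rule hilbert_end_eqI[OF zX assms(2) e(1)])
  have ne': "x \<noteq> ?e" "y \<noteq> ?e" "z \<noteq> ?e" using \<open>z \<noteq> ?e\<close> v(4) e(2) unfolding open_segment_def by blast+
  define p q r where "p = dist x ?e" and "q = dist y ?e" and "r = dist z ?e"
  have pos: "p > 0" "q > 0" "r > 0" using ne' by (simp_all add: p_def q_def r_def)
  have "funk x y = ln (p / q)" using ne by (simp only: funk_def if_False p_def q_def)
  moreover have "funk x z = ln (p / r)"
    using False unfolding funk_def e1 p_def r_def by presburger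
  moreover have "funk z y = ln (r / q)"
    using False unfolding funk_def e2 r_def q_def by presburger
  ultimately have "funk x y = ln p - ln q" "funk x z = ln p - ln r" "funk z y = ln r - ln q"
    using pos by (simp_all add: ln_div)
  then show ?thesis by linarith
qed

lemma hilbert_dist_funk:
  assumes "x \<in> X" "y \<in> X"
  shows "hilbert_dist X x y = funk x y + funk y x"
proof (cases "x = y")
  case True
  then show ?thesis by (simp add: hilbert_dist_def)
next
  case False
  have "hilbert_end X x y \<notin> X" "hilbert_end X y x \<notin> X"
    using hilbert_end assms False frontier_X by auto
  then have "x \<noteq> hilbert_end X x y" "y \<noteq> hilbert_end X x y" "x \<noteq> hilbert_end X y x" "y \<noteq> hilbert_end X y x"
    using assms by metis+
  then show ?thesis using assms False
    by (simp add: hilbert_dist_def funk_def Let_def ln_div ln_mult)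
qed

sublocale H: Metric_space X "hilbert_dist X"
proof
  fix x y z
  show sym: "hilbert_dist X x y = hilbert_dist X y x" for x y
    by (cases "x \<in> X \<and> y \<in> X") (auto simp: hilbert_dist_funk, auto simp: hilbert_dist_def)
  show "0 \<le> hilbert_dist X x y"
    by (cases "x \<in> X \<and> y \<in> X") (auto simp: hilbert_dist_funk funk_nonneg, auto simp: hilbert_dist_def)
  assume xy: "x \<in> X" "y \<in> X"
  show "hilbert_dist X x y = 0 \<longleftrightarrow> x = y"
    using funk_ray(1)[OF xy] funk_nonneg[OF xy(2,1)] by (cases "x = y") (auto simp: hilbert_dist_funk xy)
  assume z: "z \<in> X"
  show "hilbert_dist X x z \<le> hilbert_dist X x y + hilbert_dist X y z"
    using funk_triangle[OF xy z] funk_triangle[OF z xy(2,1)] by (simp add: hilbert_dist_funk xy z)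
qed

lemma hilbert_dist_segment:
  assumes "x \<in> X" "y \<in> X" "z \<in> closed_segment x y"
  shows "hilbert_dist X x y = hilbert_dist X x z + hilbert_dist X z y"
proof -
  have zX: "z \<in> X" using assms convex_X by (meson closed_segment_subset in_mono)
  have "z \<in> closed_segment y x" using assms(3) by (simp add: closed_segment_commute)
  then show ?thesis
    using funk_segment[OF assms] funk_segment[OF assms(2,1)] by (simp add: hilbert_dist_funk assms zX)
qed

text \<open>By the triangle inequality at the crossing point of the diagonals, two opposite sides have total
  length at most \<open>2 s\<close>.\<close>

lemma crossing_segments_short_side:
  assumes "a \<in> X" "b \<in> X" "c \<in> X" "e \<in> X" and "closed_segment a c \<inter> closed_segment b e \<noteq> {}"
    and "hilbert_dist X a c \<le> s" "hilbert_dist X b e \<le> s"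
  shows "hilbert_dist X a b \<le> s \<or> hilbert_dist X c e \<le> s"
proof -
  obtain z where z: "z \<in> closed_segment a c" "z \<in> closed_segment b e" using assms by auto
  have zX: "z \<in> X" using z assms convex_X by (meson closed_segment_subset in_mono)
  have "hilbert_dist X a b \<le> hilbert_dist X a z + hilbert_dist X b z"
    using H.triangle[of a z b] assms zX by (simp add: H.commute)
  moreover have "hilbert_dist X c e \<le> hilbert_dist X z c + hilbert_dist X z e"
    using H.triangle[of c z e] assms zX by (simp add: H.commute)
  ultimately show ?thesis
    using hilbert_dist_segment[OF assms(1,3) z(1)] hilbert_dist_segment[OF assms(2,4) z(2)] assms(6,7)
    by linarith
qed

end

section \<open>Chains in subsets\<close>

text \<open>For \<open>R a b \<longleftrightarrow> d a b \<le> s\<close> this is the coarse version of connectedness: the classes of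
  \<open>chain R A\<close> are the components of \<open>A\<close> at scale \<open>s\<close>.\<close>

definition chain :: "('a \<Rightarrow> 'a \<Rightarrow> bool) \<Rightarrow> 'a set \<Rightarrow> 'a \<Rightarrow> 'a \<Rightarrow> bool" where
  "chain R A x y \<longleftrightarrow> x \<in> A \<and> (\<lambda>a b. a \<in> A \<and> b \<in> A \<and> R a b)\<^sup>*\<^sup>* x y"

lemma chain_refl: "x \<in> A \<Longrightarrow> chain R A x x"
  by (simp add: chain_def)

lemma chain_start: "chain R A x y \<Longrightarrow> x \<in> A"
  by (simp add: chain_def)

lemma chain_step: "chain R A x y \<Longrightarrow> z \<in> A \<Longrightarrow> R y z \<Longrightarrow> chain R A x z"
  unfolding chain_def
  by (auto elim: rtranclp.cases intro: rtranclp.rtrancl_into_rtrancl)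

lemma chain_induct [consumes 1, case_names refl step]:
  assumes "chain R A x y" and "x \<in> A \<Longrightarrow> P x"
    and "\<And>y z. chain R A x y \<Longrightarrow> y \<in> A \<Longrightarrow> z \<in> A \<Longrightarrow> R y z \<Longrightarrow> P y \<Longrightarrow> P z"
  shows "P y"
proof -
  from assms(1) have *: "(\<lambda>a b. a \<in> A \<and> b \<in> A \<and> R a b)\<^sup>*\<^sup>* x y" and "x \<in> A" by (auto simp: chain_def)
  from * show ?thesis
    by (induction rule: rtranclp_induct) (use assms \<open>x \<in> A\<close> in \<open>auto simp: chain_def\<close>)
qed

lemma chain_end: "chain R A x y \<Longrightarrow> y \<in> A"
  by (induction rule: chain_induct) auto

lemma chain_trans: "chain R A y z \<Longrightarrow> chain R A x y \<Longrightarrow> chain R A x z"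
  by (induction rule: chain_induct) (auto intro: chain_step)

lemma chain_sym:
  assumes "chain R A x y" "symp R"
  shows "chain R A y x"
  using assms(1)
proof (induction rule: chain_induct)
  case refl
  then show ?case by (rule chain_refl)
next
  case (step y z)
  have "chain R A z y" using step assms(2) by (auto intro: chain_step chain_refl dest: sympD)
  with step.IH show ?case by (rule chain_trans)
qed

lemma chain_mono: "chain R A x y \<Longrightarrow> A \<subseteq> B \<Longrightarrow> (\<And>a b. R a b \<Longrightarrow> R' a b) \<Longrightarrow> chain R' B x y"
  by (induction rule: chain_induct) (auto intro: chain_step chain_refl)

text \<open>The discrete form of the statement that a connected set meeting both a set and its complement
  meets the boundary.\<close>

lemma chain_exit:
  assumes "chain R A x y" "P x" "\<not> P y"
  obtains a b where "a \<in> A" "b \<in> A" "R a b" "P a" "\<not> P b"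
proof -
  have "\<not> P y \<longrightarrow> (\<exists>a b. a \<in> A \<and> b \<in> A \<and> R a b \<and> P a \<and> \<not> P b)"
    using assms(1) by (induction rule: chain_induct) (use assms(2) in blast)+
  with assms(3) that show thesis by blast
qed

lemma chain_const:
  assumes "chain R A x y" and "\<And>a b. a \<in> A \<Longrightarrow> b \<in> A \<Longrightarrow> R a b \<Longrightarrow> g a = g b"
  shows "chain R {z \<in> A. g z = g x} x y"
  using assms(1)
proof (induction rule: chain_induct)
  case refl
  then show ?case by (simp add: chain_refl)
next
  case (step y z)
  then have "g y = g x" using chain_end by fastforce
  then have "g z = g x" using assms(2)[OF step.hyps(2-4)] by simp
  with step show ?case by (simp add: chain_step)
qed

lemma chain_map:
  assumes "chain R A x y" "\<And>a. a \<in> A \<Longrightarrow> h a \<in> B" "\<And>a b. a \<in> A \<Longrightarrow> b \<in> A \<Longrightarrow> R a b \<Longrightarrow> R' (h a) (h b)"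
  shows "chain R' B (h x) (h y)"
  using assms(1)
proof (induction rule: chain_induct)
  case refl
  then show ?case by (intro chain_refl assms(2))
next
  case (step y z)
  from step.IH assms(2)[OF step.hyps(3)] assms(3)[OF step.hyps(2-4)] show ?case by (rule chain_step)
qed

lemma relpowp_sym:
  assumes "symp R"
  shows "(R ^^ n) x y \<Longrightarrow> (R ^^ n) y x"
proof (induction n arbitrary: y)
  case (Suc n)
  then obtain w where "(R ^^ n) x w" "R w y" by auto
  with Suc.IH assms show ?case by (metis relpowp_Suc_I2 sympD)
qed auto

lemma relpowp_trans: "(R ^^ m) x y \<Longrightarrow> (R ^^ n) y z \<Longrightarrow> (R ^^ (m + n)) x z"
  by (metis relcomppI relpowp_add)

section \<open>Breadth-first levels of a crossing graph\<close>

text \<open>For a vertex that cannot be reached from \<open>q\<close> this is the unspecified value of \<open>LEAST\<close>; the facts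
  about it therefore assume reachability.\<close>

definition bfs_level :: "('a \<Rightarrow> 'a \<Rightarrow> bool) \<Rightarrow> 'a \<Rightarrow> 'a \<Rightarrow> nat" where
  "bfs_level R q x = (LEAST n. (R ^^ n) q x)"

definition within_steps :: "('a \<Rightarrow> 'a \<Rightarrow> bool) \<Rightarrow> nat \<Rightarrow> 'a \<Rightarrow> 'a \<Rightarrow> bool" where
  "within_steps R k x y \<longleftrightarrow> (\<exists>n\<le>k. (R ^^ n) x y)"

lemma bfs_level_le: "(R ^^ n) q x \<Longrightarrow> bfs_level R q x \<le> n"
  unfolding bfs_level_def by (rule Least_le)

lemma bfs_level_relpowp: "(R ^^ n) q x \<Longrightarrow> (R ^^ bfs_level R q x) q x"
  unfolding bfs_level_def by (rule LeastI)

lemma bfs_level_step: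
  assumes "R a b" "(R ^^ k) q a"
  shows "bfs_level R q b \<le> Suc (bfs_level R q a)"
  using bfs_level_le[of "Suc (bfs_level R q a)" R q b] bfs_level_relpowp[OF assms(2)] assms(1) by auto

text \<open>A coarse form of a rooted outerplanar graph. The vertices sit on a circle that is cut open at the
  root \<open>q\<close> and parametrized by \<open>u\<close>; the edges are chords. Chords may cross, but then the crossing is
  short-circuited by an edge between their ends.\<close>

locale crossing_graph =
  fixes V :: "'a set" and R :: "'a \<Rightarrow> 'a \<Rightarrow> bool" and u :: "'a \<Rightarrow> real" and q :: 'a
  assumes sym: "symp R" and refl: "x \<in> V \<Longrightarrow> R x x" and R_V: "R x y \<Longrightarrow> x \<in> V \<and> y \<in> V"
    and inj: "inj_on u V" and q: "q \<in> V" "\<And>x. x \<in> V \<Longrightarrow> u q \<le> u x"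
    and crossing: "\<lbrakk>R a c; R b e; u a < u b; u b < u c; u c < u e\<rbrakk> \<Longrightarrow> R a b \<or> R c e"
begin

text \<open>Paths between interlaced pairs of points contain a pair of crossing edges: some edge of the first
  path enters the interval between \<open>b\<close> and \<open>e\<close>, and since its two ends separate \<open>b\<close> from \<open>e\<close>, some
  edge of the second path crosses it. Unless the two paths share a vertex, the crossing condition then
  provides an edge between them.\<close>

lemma path_crossing:
  assumes A: "chain R A a c" and B: "chain R B b e" and V: "A \<subseteq> V" "B \<subseteq> V"
    and less: "u a < u b" "u b < u c" "u c < u e"
  obtains x y where "x \<in> A" "y \<in> B" "R x y"
proof (rule ccontr)
  assume "\<not> thesis"
  then have no: "\<not> R x y" if "x \<in> A" "y \<in> B" for x y
    using that \<open>\<And>y x. x \<in> A \<Longrightarrow> y \<in> B \<Longrightarrow> R x y \<Longrightarrow> thesis\<close> by blast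
  have no': "\<not> R y x" if "x \<in> A" "y \<in> B" for x y
    using no[OF that] sym by (auto dest: sympD)
  have ne: "u x \<noteq> u y" if "x \<in> A" "y \<in> B" for x y
    using no[OF that] that inj refl V by (metis in_mono inj_onD)
  have bB: "b \<in> B" "e \<in> B" using B chain_start chain_end by metis+
  obtain x x' where x: "x \<in> A" "x' \<in> A" "R x x'" "\<not> (u b < u x \<and> u x < u e)" "u b < u x'" "u x' < u e"
    by (rule chain_exit[OF A, of "\<lambda>v. \<not> (u b < u v \<and> u v < u e)"]) (use less in auto)
  have x': "R x' x" using x sym by (auto dest: sympD)
  from x(4) ne[OF x(1) bB(1)] ne[OF x(1) bB(2)] consider "u x < u b" | "u e < u x" by fastforce
  then show False
  proof cases
    case 1
    obtain y y' where y: "y \<in> B" "y' \<in> B" "R y y'" "u x < u y" "u y < u x'" "\<not> (u x < u y' \<and> u y' < u x')"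
      by (rule chain_exit[OF B, of "\<lambda>v. u x < u v \<and> u v < u x'"]) (use 1 x less in auto)
    have y': "R y' y" using y sym by (auto dest: sympD)
    from y(6) ne[OF x(1) y(2)] ne[OF x(2) y(2)] consider "u y' < u x" | "u x' < u y'" by fastforce
    then show False
    proof cases
      case 1
      then show False using crossing[OF y' x(3)] y(4-6) x(4-6) 1 no'[OF x(1) y(2)] no'[OF x(2) y(1)] by auto
    next
      case 2
      then show False using crossing[OF x(3) y(3)] y(4-6) x(4-6) 2 no[OF x(1) y(1)] no[OF x(2) y(2)] by auto
    qed
  next
    case 2
    obtain y y' where y: "y \<in> B" "y' \<in> B" "R y y'" "\<not> (u x' < u y \<and> u y < u x)" "u x' < u y'" "u y' < u x"
      by (rule chain_exit[OF B, of "\<lambda>v. \<not> (u x' < u v \<and> u v < u x)"]) (use 2 x less in auto)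
    have y': "R y' y" using y sym by (auto dest: sympD)
    from y(4) ne[OF x(1) y(1)] ne[OF x(2) y(1)] consider "u y < u x'" | "u x < u y" by fastforce
    then show False
    proof cases
      case 1
      then show False using crossing[OF y(3) x'] y(4-6) x(4-6) 1 no'[OF x(2) y(1)] no'[OF x(1) y(2)] by auto
    next
      case 2
      then show False using crossing[OF x' y'] y(4-6) x(4-6) 2 no[OF x(2) y(2)] no[OF x(1) y(1)] by auto
    qed
  qed
qed

abbreviation near :: "nat \<Rightarrow> 'a \<Rightarrow> 'a \<Rightarrow> bool" where "near \<equiv> within_steps R"

abbreviation lev :: "'a \<Rightarrow> nat" where "lev \<equiv> bfs_level R q"

definition level_set :: "nat \<Rightarrow> 'a set" where "level_set n = {x \<in> V. (R ^^ n) q x \<and> lev x = n}"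

lemma near_sym: "near k x y \<Longrightarrow> near k y x"
  unfolding within_steps_def using relpowp_sym[OF sym] by blast

lemma near_trans: "near k x y \<Longrightarrow> near l y z \<Longrightarrow> near (k + l) x z"
  unfolding within_steps_def using relpowp_trans by (metis add_mono)

lemma near_edge: "R x y \<Longrightarrow> near 1 x y"
  unfolding within_steps_def by (intro exI[of _ 1]) auto

lemma near_mono: "near k x y \<Longrightarrow> k \<le> l \<Longrightarrow> near l x y"
  unfolding within_steps_def by (meson le_trans)

lemma relpowp_V: "(R ^^ n) x y \<Longrightarrow> x \<in> V \<Longrightarrow> y \<in> V"
  by (induction n arbitrary: y) (auto dest: R_V)

text \<open>Recording the number of steps to both ends keeps track of the level of each vertex of the path and
  of its distance to \<open>y\<close>.\<close>

lemma geodesic: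
  assumes "(R ^^ m) x y" "x \<in> V"
  shows "chain R {v. \<exists>i\<le>m. (R ^^ i) x v \<and> (R ^^ (m - i)) v y} x y"
proof -
  have "\<exists>w. chain R {v. \<exists>i\<le>m. (R ^^ i) x v \<and> (R ^^ (m - i)) v y} x w \<and> (R ^^ k) x w \<and> (R ^^ (m - k)) w y" if "k \<le> m" for k
    using that
  proof (induction k)
    case 0
    then show ?case using assms by (intro exI[of _ x]) (auto intro!: chain_refl exI[of _ 0])
  next
    case (Suc k)
    then obtain w where w: "chain R {v. \<exists>i\<le>m. (R ^^ i) x v \<and> (R ^^ (m - i)) v y} x w" "(R ^^ k) x w" "(R ^^ (m - k)) w y"
      by auto
    moreover have "m - k = Suc (m - Suc k)" using Suc by simp
    ultimately obtain w' where w': "R w w'" "(R ^^ (m - Suc k)) w' y" by (metis relpowp_Suc_D2)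
    have "(R ^^ Suc k) x w'" using w w' by auto
    then show ?case using w w' Suc.prems by (intro exI[of _ w'] conjI) (auto intro!: chain_step[OF w(1)] exI[of _ "Suc k"])
  qed
  from this[of m] show ?thesis by auto
qed

text \<open>Let \<open>s\<close> be two levels above \<open>z\<close> on a geodesic from the root \<open>q\<close> to \<open>z\<close>. If \<open>s\<close> lies between \<open>x\<close>
  and \<open>y\<close>, then the path from \<open>q\<close> to \<open>s\<close> crosses a path inside level \<open>n\<close>, which is impossible because
  the levels of the two paths differ by at least two. Otherwise the path from \<open>s\<close> to \<open>z\<close> crosses a
  geodesic from \<open>q\<close> to \<open>x\<close> or to \<open>y\<close>. The vertices where they become adjacent have level at least
  \<open>n - 3\<close>, which gives at most \<open>2 + 1 + 3\<close> steps from \<open>z\<close> to the end of that geodesic. For \<open>n \<le> 2\<close> a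
  detour through \<open>q\<close> is short enough.\<close>

lemma middle_near:
  assumes x: "chain R (level_set n) z x" and y: "chain R (level_set n) z y"
    and less: "u x < u z" "u z < u y"
  shows "near 6 z x \<or> near 6 z y"
proof -
  have in_L: "x \<in> level_set n" "y \<in> level_set n" "z \<in> level_set n" using x y chain_start chain_end by metis+
  then have V: "x \<in> V" "y \<in> V" "z \<in> V" and qn: "(R ^^ n) q x" "(R ^^ n) q y" "(R ^^ n) q z" "lev z = n" "lev x = n" "lev y = n"
    by (auto simp: level_set_def)
  show ?thesis
  proof (cases "n \<le> 2")
    case True
    have "(R ^^ (n + n)) z x" using relpowp_trans[OF relpowp_sym[OF sym qn(3)] qn(1)] .
    then have "near (n + n) z x" unfolding within_steps_def by blast
    then have "near 6 z x" by (rule near_mono) (use True in simp)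
    then show ?thesis ..
  next
    case False
    then obtain m where m: "n = m + 2" "m > 0" by (metis add.commute gr0I le_add_diff_inverse linear add_0)
    \<comment> \<open>Two levels are enough to rule out adjacency to level \<open>n\<close>.\<close>
    then obtain s where s: "(R ^^ m) q s" "(R ^^ 2) s z" using qn(3) by (metis relcomppE relpowp_add)
    then obtain t where t: "R s t" "R t z" by (auto simp: numeral_2_eq_2)
    have Vst: "s \<in> V" "t \<in> V" using R_V t by auto
    note step = bfs_level_step[of R _ _ _ q]
    have levs: "lev s = m"
    proof -
      have "(R ^^ (lev s + 2)) q z" using relpowp_trans[OF bfs_level_relpowp[OF s(1)] s(2)] .
      then show ?thesis using bfs_level_le[of "lev s + 2" R q z] bfs_level_le[OF s(1)] qn m by simp
    qed
    have "near (1 + 1) s z" using near_trans[OF near_edge[OF t(1)] near_edge[OF t(2)]] .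
    moreover have "near 2 t z" using near_mono[OF near_edge[OF t(2)], of 2] by simp
    moreover have "near 2 z z" unfolding within_steps_def by (intro exI[of _ 0]) auto
    ultimately have st: "near 2 s z" "near 2 t z" "near 2 z z" by (simp_all add: numeral_2_eq_2)
    have seg: "chain R {s,t,z} s z"
      using t by (meson chain_refl chain_step insertI1 insertI2)
    have seg': "chain R {s,t,z} z s" using chain_sym[OF seg sym] .
    let ?low = "{v. \<exists>i\<le>m. (R ^^ i) q v \<and> (R ^^ (m - i)) v s}"
    have low: "chain R ?low q s" using geodesic[OF s(1) q(1)] .
    have no_low: False if v: "v \<in> ?low" and w: "w \<in> level_set n" and vw: "R v w" for v w
    proof -
      obtain i where i: "i \<le> m" "(R ^^ i) q v" using v by auto
      then show False using step[OF vw i(2)] bfs_level_le[OF i(2)] w m by (auto simp: level_set_def)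
    qed
    have tail: "near 6 z w" if w: "w \<in> level_set n" and a: "a \<in> {v. \<exists>i\<le>n. (R ^^ i) q v \<and> (R ^^ (n - i)) v w}"
      and b: "b \<in> {s,t,z}" and ab: "R a b" for w a b
    proof -
      obtain i where i: "i \<le> n" "(R ^^ i) q a" "(R ^^ (n - i)) a w" using a by auto
      have "lev b \<ge> m"
      proof -
        have "lev t \<ge> m"
          using step[OF t(2) relpowp_Suc_I[OF s(1) t(1)]] qn m by simp
        then show ?thesis using b levs qn m by auto
      qed
      then have "m \<le> Suc i" using step[OF ab i(2)] bfs_level_le[OF i(2)] by simp
      then have "near 3 a w" using i m unfolding within_steps_def by (intro exI[of _ "n - i"]) auto
      moreover have "near 2 z b" using b st by (auto intro: near_sym)
      moreover have "near 1 b a" using near_edge ab sym by (auto dest: sympD)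
      ultimately have "near (2 + (1 + 3)) z w" using near_trans by blast
      then show ?thesis by simp
    qed
    have sub: "?low \<subseteq> V" "level_set n \<subseteq> V" "{s,t,z} \<subseteq> V" "{v. \<exists>i\<le>n. (R ^^ i) q v \<and> (R ^^ (n - i)) v w} \<subseteq> V" for w
      using relpowp_V q(1) Vst V by (auto simp: level_set_def)
    have ne: "s \<noteq> q" "s \<noteq> x" "s \<noteq> y" "s \<noteq> z"  "x \<noteq> q"
    proof -
      have "lev q = 0" using bfs_level_le[of 0 R q q] by simp
      then show "s \<noteq> q" "x \<noteq> q" "s \<noteq> x" "s \<noteq> y" "s \<noteq> z" using levs m qn by auto
    qed
    have qlt: "u q < u s" "u q < u x"
      using q ne Vst V inj by (metis inj_onD order_le_less)+
    have "u s \<noteq> u x" "u s \<noteq> u y" "u s \<noteq> u z" using ne Vst V inj by (metis inj_onD)+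
    then consider "u s < u x" | "u x < u s" "u s < u z" | "u z < u s" "u s < u y" | "u y < u s" by fastforce
    then show ?thesis
    proof cases
      case 1
      from path_crossing[OF geodesic[OF qn(1) q(1)] seg sub(4) sub(3) qlt(1) 1 less(1)]
      obtain a b where "a \<in> {v. \<exists>i\<le>n. (R ^^ i) q v \<and> (R ^^ (n - i)) v x}" "b \<in> {s,t,z}" "R a b" .
      from tail[OF in_L(1) this] show ?thesis ..
    next
      case 2
      from path_crossing[OF low chain_sym[OF x sym] sub(1,2) qlt(2) 2]
      obtain a b where "a \<in> ?low" "b \<in> level_set n" "R a b" .
      from no_low[OF this] show ?thesis ..
    next
      case 3
      have "u q < u z" using qlt less by simp
      from path_crossing[OF low y sub(1,2) this 3]
      obtain a b where "a \<in> ?low" "b \<in> level_set n" "R a b" .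
      from no_low[OF this] show ?thesis ..
    next
      case 4
      have "u q < u z" using qlt less by simp
      from path_crossing[OF geodesic[OF qn(2) q(1)] seg' sub(4) sub(3) this less(2) 4]
      obtain a b where "a \<in> {v. \<exists>i\<le>n. (R ^^ i) q v \<and> (R ^^ (n - i)) v y}" "b \<in> {s,t,z}" "R a b" .
      from tail[OF in_L(2) this] show ?thesis ..
    qed
  qed
qed

text \<open>If \<open>x\<close> and \<open>y\<close> are more than six steps apart, applying \<open>middle_near\<close> to \<open>x\<close>, \<open>y\<close> and a third vertex
  \<open>z\<close> of their component, in any order, shows that \<open>z\<close> is within six steps of \<open>x\<close> or of \<open>y\<close>. Along a
  chain from \<open>x\<close> to \<open>y\<close> the first possibility has to give way to the second across a single edge,
  whence \<open>13 = 6 + 1 + 6\<close>.\<close>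

lemma level_component_bounded:
  assumes xy: "chain R (level_set n) x y"
  shows "near 13 x y"
proof (cases "near 6 x y")
  case True
  then show ?thesis by (rule near_mono) simp
next
  case far: False
  have yx: "chain R (level_set n) y x" using chain_sym[OF xy sym] .
  have V: "level_set n \<subseteq> V" by (auto simp: level_set_def)
  have all: "near 6 z x \<or> near 6 z y" if z: "chain R (level_set n) x z" for z
  proof -
    have zx: "chain R (level_set n) z x" using chain_sym[OF z sym] .
    have zy: "chain R (level_set n) z y" using chain_trans[OF xy zx] .
    have yz: "chain R (level_set n) y z" using chain_sym[OF zy sym] .
    have far': "\<not> near 6 y x" using far near_sym by blast
    have "near 6 z z" unfolding within_steps_def by (intro exI[of _ 0]) auto
    have "u x \<noteq> u z \<or> x = z" "u y \<noteq> u z \<or> y = z" "u x \<noteq> u y \<or> x = y"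
      using inj V chain_start chain_end xy z by (metis in_mono inj_onD)+
    then consider "x = z \<or> y = z \<or> x = y" | "u x < u z" "u z < u y" | "u y < u z" "u z < u x"
      | "u z < u x" "u x < u y" | "u y < u x" "u x < u z" | "u x < u y" "u y < u z" | "u z < u y" "u y < u x"
      by argo
    then show ?thesis
    proof cases
      case 1
      moreover have "x \<noteq> y" using far by (auto simp: within_steps_def)
      ultimately show ?thesis using \<open>near 6 z z\<close> by auto
    next
      case 2
      then show ?thesis using middle_near[OF zx zy] by blast
    next
      case 3
      then show ?thesis using middle_near[OF zy zx] by blast
    next
      case 4
      then show ?thesis using middle_near[OF z xy] far near_sym by blast
    next
      case 5
      then show ?thesis using middle_near[OF xy z] far near_sym by blast
    next
      case 6
      then show ?thesis using middle_near[OF yx yz] far' near_sym by blast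
    next
      case 7
      then show ?thesis using middle_near[OF yz yx] far' near_sym by blast
    qed
  qed
  have "near 6 x x" "near 6 y y" unfolding within_steps_def by (intro exI[of _ 0]; simp)+
  define A where "A = {z. chain R (level_set n) x z}"
  have "chain R A x y"
    using xy unfolding A_def by (induction rule: chain_induct) (auto intro: chain_refl chain_step)
  then obtain a b where ab: "a \<in> A" "b \<in> A" "R a b" "near 6 a x" "\<not> near 6 b x"
    by (rule chain_exit[where P = "\<lambda>v. near 6 v x"]) (use \<open>near 6 x x\<close> far near_sym in blast)+
  then have "near 6 b y" using all[of b] by (auto simp: A_def)
  then have "near (6 + (1 + 6)) x y"
    using near_trans[OF near_sym[OF ab(4)] near_trans[OF near_edge[OF ab(3)]]] by blast
  then show ?thesis by simp
qed

end

section \<open>Subsets with bounded coarse components\<close>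

text \<open>A set of this kind has asymptotic dimension zero as seen at scale \<open>s\<close>. Dimension at most \<open>n\<close> will be
  handled as a union of \<open>n + 1\<close> such sets.\<close>

definition components_bounded :: "('a \<Rightarrow> 'a \<Rightarrow> real) \<Rightarrow> real \<Rightarrow> real \<Rightarrow> 'a set \<Rightarrow> bool" where
  "components_bounded d s D A \<longleftrightarrow> (\<forall>x y. chain (\<lambda>a b. d a b \<le> s) A x y \<longrightarrow> d x y \<le> D)"

lemma components_bounded_empty [simp]: "components_bounded d s D {}"
  by (auto simp: components_bounded_def dest: chain_start)

lemma components_bounded_mono:
  assumes "components_bounded d s D A" "B \<subseteq> A" "s' \<le> s" "D \<le> D'"
  shows "components_bounded d s' D' B"
  unfolding components_bounded_def
proof (intro allI impI)
  fix x y assume "chain (\<lambda>a b. d a b \<le> s') B x y"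
  then have "chain (\<lambda>a b. d a b \<le> s) A x y" by (rule chain_mono) (use assms in auto)
  then have "d x y \<le> D" using assms(1) by (simp add: components_bounded_def)
  then show "d x y \<le> D'" using assms(4) by simp
qed

text \<open>If steps of length at most \<open>s\<close> cannot change the label \<open>g\<close>, a chain stays within one class.\<close>

lemma components_bounded_label:
  assumes "\<And>i. components_bounded d s D {x \<in> A. g x = i}"
    and "\<And>x y. x \<in> A \<Longrightarrow> y \<in> A \<Longrightarrow> d x y \<le> s \<Longrightarrow> g x = g y"
  shows "components_bounded d s D A"
  unfolding components_bounded_def
proof (intro allI impI)
  fix x y assume "chain (\<lambda>a b. d a b \<le> s) A x y"
  from chain_const[OF this, of g] assms have "chain (\<lambda>a b. d a b \<le> s) {z \<in> A. g z = g x} x y" by blast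
  then show "d x y \<le> D" using assms(1)[of "g x"] unfolding components_bounded_def by blast
qed

context Metric_space
begin

text \<open>Between two consecutive visits to \<open>B\<close>, a chain at scale \<open>s\<close> remains in one component of \<open>A\<close>, so these
  visits are at distance at most \<open>D + 2 * s\<close> and belong to the same component of \<open>B\<close> at that larger
  scale. Only the initial and the final piece of the chain have to be added.\<close>

lemma components_bounded_Un:
  assumes A: "components_bounded d s D A" and B: "components_bounded d (D + 2 * s) D' B"
    and sub: "A \<subseteq> M" "B \<subseteq> M" and pos: "s \<ge> 0" "D \<ge> 0" "D' \<ge> 0"
  shows "components_bounded d s (D' + 2 * (D + s)) (A \<union> B)"
  unfolding components_bounded_def
proof (intro allI impI)
  fix x y
  let ?R = "\<lambda>a b. d a b \<le> s" and ?R' = "\<lambda>a b. d a b \<le> D + 2 * s"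
  assume "chain ?R (A \<union> B) x y"
  \<comment> \<open>\<open>q\<close> is a first (or last) visit to \<open>B\<close>, reached from \<open>x\<close> through one component of \<open>A\<close>.\<close>
  define attached where "attached x q \<longleftrightarrow> x = q \<or> (\<exists>x'. chain ?R A x x' \<and> d x' q \<le> s)" for x q
  have att: "d x q \<le> D + s" if xq: "attached x q" "x \<in> M" "q \<in> M" for x q
  proof (cases "x = q")
    case True
    then show ?thesis using pos that by simp
  next
    case False
    then obtain x' where x': "chain ?R A x x'" "d x' q \<le> s" using xq(1) unfolding attached_def by blast
    then have "x' \<in> M" using sub chain_end[OF x'(1)] by blast
    moreover have "d x x' \<le> D" using A x' by (auto simp: components_bounded_def)
    ultimately show ?thesis using triangle[of x x' q] xq x' by linarith
  qed
  have symR: "symp ?R" by (auto simp: symp_def commute)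
  from \<open>chain ?R (A \<union> B) x y\<close>
  have "chain ?R A x y \<or> (\<exists>q q'. attached x q \<and> chain ?R' B q q' \<and> attached y q')"
  proof (induction rule: chain_induct)
    case refl
    then show ?case by (auto simp: attached_def intro: chain_refl)
  next
    case (step y z)
    have M: "y \<in> M" "z \<in> M" using step sub by auto
    from step.IH show ?case
    proof
      assume xy: "chain ?R A x y"
      show ?thesis
      proof (cases "z \<in> A")
        case True
        then show ?thesis using chain_step[OF xy True] step by auto
      next
        case False
        then have "attached x z" "z \<in> B" using xy step by (auto simp: attached_def)
        then show ?thesis by (auto simp: attached_def intro: chain_refl)
      qed
    next
      assume "\<exists>q q'. attached x q \<and> chain ?R' B q q' \<and> attached y q'"
      then obtain q q' where q: "attached x q" "chain ?R' B q q'" "attached y q'" by blast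
      have q'B: "q' \<in> B" "q' \<in> M" using chain_end[OF q(2)] sub by blast+
      show ?thesis
      proof (cases "z \<in> B")
        case True
        have "d q' z \<le> D + 2 * s"
          using triangle[of q' y z] att[OF q(3)] M q'B step by (simp add: commute)
        then have "chain ?R' B q z" using chain_step[OF q(2)] True by blast
        then show ?thesis using q by (auto simp: attached_def)
      next
        case False
        then have zA: "z \<in> A" using step by auto
        have "attached z q'"
        proof (cases "y = q'")
          case True
          then show ?thesis using step zA by (auto simp: attached_def commute intro: chain_refl)
        next
          case False
          then obtain x' where x': "chain ?R A y x'" "d x' q' \<le> s" using q(3) unfolding attached_def by blast
          have "chain ?R A z y" using chain_step[OF chain_refl[OF zA]] chain_start[OF x'(1)] step by (simp add: commute)
          from chain_trans[OF x'(1) this] x' show ?thesis by (auto simp: attached_def)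
        qed
        then show ?thesis using q by auto
      qed
    qed
  qed
  then show "d x y \<le> D' + 2 * (D + s)"
  proof
    assume "chain ?R A x y"
    then have "d x y \<le> D" using A by (auto simp: components_bounded_def)
    then show ?thesis using pos by simp
  next
    assume "\<exists>q q'. attached x q \<and> chain ?R' B q q' \<and> attached y q'"
    then obtain q q' where q: "attached x q" "chain ?R' B q q'" "attached y q'" by blast
    have M: "q \<in> M" "q' \<in> M" using chain_start[OF q(2)] chain_end[OF q(2)] sub by blast+
    have xy: "x \<in> M" "y \<in> M" 
      using chain_start[OF \<open>chain ?R (A \<union> B) x y\<close>] chain_end[OF \<open>chain ?R (A \<union> B) x y\<close>] sub by blast+
    have "d q q' \<le> D'" using B q by (auto simp: components_bounded_def)
    then show ?thesis
      using triangle[of x q y] triangle[of q q' y] att[OF q(1)] att[OF q(3)] M xy by (simp add: commute)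
  qed
qed

text \<open>The cover consists of the components of the three sets at scale \<open>2 * r\<close>. Two points of a closed
  ball of radius \<open>r\<close> are at distance at most \<open>2 * r\<close>, so the ball meets at most one component of each.\<close>

lemma asdim_le_2I:
  assumes "\<And>s. s > 0 \<Longrightarrow> \<exists>C D. M = (\<Union>i<3::nat. C i) \<and> (\<forall>i<3. components_bounded d s D (C i))"
  shows "asdim_le M d 2"
  unfolding asdim_le_def
proof (intro allI impI)
  fix r :: real assume "r > 0"
  then obtain C D where C: "M = (\<Union>i<3::nat. C i)" and D: "\<forall>i<3. components_bounded d (2 * r) D (C i)"
    using assms[of "2 * r"] by auto
  define R where "R = (\<lambda>a b. d a b \<le> 2 * r)"
  have symR: "symp R" by (auto simp: R_def symp_def commute)
  define K where "K i x = {y. chain R (C i) x y}" for i x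
  define \<U> where "\<U> = (\<Union>i<3. K i ` C i)"
  have sub: "K i x \<subseteq> C i" for i x unfolding K_def by (auto dest: chain_end)
  have Keq: "K i x = K i y" if "chain R (C i) x y" for i x y
    unfolding K_def by (intro Collect_cong iffI; erule chain_trans) (rule chain_sym[OF that symR], rule that)
  have CM: "C i \<subseteq> M" if "i < 3" for i using C that by auto
  have "\<U> \<subseteq> Pow M" using sub CM by (fastforce simp: \<U>_def)
  moreover have "\<Union>\<U> = M"
  proof
    show "\<Union>\<U> \<subseteq> M" using \<open>\<U> \<subseteq> Pow M\<close> by auto
    show "M \<subseteq> \<Union>\<U>" using C by (auto simp: \<U>_def K_def intro: chain_refl)
  qed
  moreover have "uniformly_bounded d \<U>"
    unfolding uniformly_bounded_def
  proof (intro exI[of _ D] ballI)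
    fix U x y assume "U \<in> \<U>" "x \<in> U" "y \<in> U"
    then obtain i z where i: "i < 3" and z: "chain R (C i) z x" "chain R (C i) z y" by (auto simp: \<U>_def K_def)
    have "chain R (C i) x y" using chain_trans[OF z(2) chain_sym[OF z(1) symR]] .
    then show "d x y \<le> D" using D \<open>i < 3\<close> by (auto simp: components_bounded_def R_def)
  qed
  moreover have "r_multiplicity M d r \<U> \<le> enat (2 + 1)"
  proof -
    have "finite {U\<in>\<U>. U \<inter> mcball x r \<noteq> {}} \<and> card {U\<in>\<U>. U \<inter> mcball x r \<noteq> {}} \<le> 3" if xM: "x \<in> M" for x
    proof -
      define hit where "hit i = (THE U. U \<in> K i ` C i \<and> U \<inter> mcball x r \<noteq> {})" for i
      have "U = hit i" if U: "i < 3" "U \<in> K i ` C i" "U \<inter> mcball x r \<noteq> {}" for i U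
        unfolding hit_def
      proof (rule the_equality[symmetric])
        show "U \<in> K i ` C i \<and> U \<inter> mcball x r \<noteq> {}" using U by auto
        fix W assume W: "W \<in> K i ` C i \<and> W \<inter> mcball x r \<noteq> {}"
        obtain a a' where a: "U = K i a" "a' \<in> K i a" "a' \<in> mcball x r" using U(2,3) by blast
        obtain b b' where b: "W = K i b" "b' \<in> K i b" "b' \<in> mcball x r" using W by blast
        have "d a' x \<le> r" "d x b' \<le> r" "a' \<in> M" "b' \<in> M" using a(3) b(3) by (simp_all add: commute)
        then have "R a' b'" using triangle[of a' x b'] xM unfolding R_def by linarith
        moreover have "a' \<in> C i" "b' \<in> C i" using a(2) b(2) sub by blast+
        ultimately have "chain R (C i) a' b'" using chain_step[OF chain_refl] by metis
        then have "K i a' = K i b'" by (rule Keq)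
        moreover have "K i a = K i a'" "K i b = K i b'" using a(2) b(2) Keq[of i] unfolding K_def by blast+
        ultimately show "W = U" using a b by simp
      qed
      then have hits: "{U\<in>\<U>. U \<inter> mcball x r \<noteq> {}} \<subseteq> hit ` {..<3}" unfolding \<U>_def by blast
      have "card (hit ` {..<3}) \<le> 3" using card_image_le[of "{..<3}" hit] by simp
      then show ?thesis using hits finite_subset[OF hits] card_mono[OF _ hits] by (meson finite_imageI finite_lessThan le_trans)
    qed
    then show ?thesis unfolding r_multiplicity_def by (intro Inf_lower) auto
  qed
  ultimately show "\<exists>\<U>\<subseteq>Pow M. \<Union>\<U> = M \<and> uniformly_bounded d \<U> \<and> r_multiplicity M d r \<U> \<le> enat (2 + 1)"
    by blast
qed

text \<open>The bands \<open>k = n\<close> with \<open>n + j\<close> congruent to \<open>3\<close> modulo \<open>4\<close> are absent, hence a chain is confined to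
  a block of three consecutive bands, with even, odd and even index. In a block there is a single
  summand \<open>Q n\<close>, to which \<open>components_bounded_Un\<close> applies, although the scale \<open>D + 2 * s\<close> may be much
  larger than the width of a band.\<close>

lemma components_bounded_block:
  fixes k :: "'a \<Rightarrow> nat"
  assumes EO: "\<And>n. even n \<Longrightarrow> A n \<subseteq> {x \<in> M. k x = n}" "\<And>n. even n \<Longrightarrow> components_bounded d s D (A n)"
    and Q: "\<And>n. Q n \<subseteq> {x \<in> M. k x = n}" "\<And>n. components_bounded d (D + 2 * s) D' (Q n)"
    and k: "\<And>x y. x \<in> M \<Longrightarrow> y \<in> M \<Longrightarrow> d x y \<le> s \<Longrightarrow> k x \<le> k y + 1"
    and pos: "s \<ge> 0" "D \<ge> 0" "D' \<ge> 0" and j: "even j"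
  shows "components_bounded d s (D' + 2 * (D + s)) ((\<Union>n\<in>{n. even n}. A n) \<union> (\<Union>n\<in>{n. (n + j) mod 4 = 1}. Q n))"
    (is "components_bounded d s _ ?C")
proof (rule components_bounded_label[where g = "\<lambda>x. (k x + j) div 4"])
  have k4: "(k x + j) mod 4 \<noteq> 3" if "x \<in> ?C" for x
  proof -
    from that have "even (k x) \<or> (k x + j) mod 4 = 1" using EO(1) Q(1) by fastforce
    then show ?thesis using j by presburger
  qed
  have div4: "Suc a div 4 = a div 4" if "a mod 4 \<noteq> 3" for a :: nat using that by presburger
  have CM: "?C \<subseteq> M" using EO(1) Q(1) by blast
  show "(k x + j) div 4 = (k y + j) div 4" if "x \<in> ?C" "y \<in> ?C" "d x y \<le> s" for x y
  proof -
    have "k x \<le> k y + 1" "k y \<le> k x + 1" using k[of x y] k[of y x] that CM by (auto simp: commute)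
    then consider "k x + j = k y + j" | "k x + j = Suc (k y + j)" | "k y + j = Suc (k x + j)" by linarith
    then show ?thesis
      by cases (simp_all add: div4[OF k4[OF that(1)]] div4[OF k4[OF that(2)]])
  qed
  fix i
  define A' where "A' = {x \<in> (\<Union>n\<in>{n. even n}. A n). (k x + j) div 4 = i}"
  define Q' where "Q' = {x \<in> (\<Union>n\<in>{n. (n + j) mod 4 = 1}. Q n). (k x + j) div 4 = i}"
  have A'M: "A' \<subseteq> M" "Q' \<subseteq> M" using CM by (auto simp: A'_def Q'_def)
  have "components_bounded d s D A'"
  proof (rule components_bounded_label[where g = k])
    fix n
    have "{x \<in> A'. k x = n} \<subseteq> (if even n then A n else {})"
      using EO(1) by (fastforce simp: A'_def)
    moreover have "components_bounded d s D (if even n then A n else {})" using EO(2)[of n] by simp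
    ultimately show "components_bounded d s D {x \<in> A'. k x = n}"
      by (auto intro: components_bounded_mono)
  next
    fix x y assume xy: "x \<in> A'" "y \<in> A'" "d x y \<le> s"
    have "even (k x)" "even (k y)" using xy EO(1) by (fastforce simp: A'_def)+
    moreover have "k x \<le> k y + 1" "k y \<le> k x + 1" using k[of x y] k[of y x] xy A'M by (auto simp: commute)
    ultimately show "k x = k y" by presburger
  qed
  moreover have "components_bounded d (D + 2 * s) D' Q'"
  proof -
    have "Q' \<subseteq> Q (4 * i + 1 - j)"
    proof
      fix x assume "x \<in> Q'"
      then obtain n where n: "x \<in> Q n" "(n + j) mod 4 = 1" "(k x + j) div 4 = i" by (auto simp: Q'_def)
      then have "k x = n" using Q(1) by blast
      then have "n = 4 * i + 1 - j" using n by presburger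
      then show "x \<in> Q (4 * i + 1 - j)" using n by simp
    qed
    then show ?thesis using Q(2) by (auto intro: components_bounded_mono)
  qed
  ultimately have "components_bounded d s (D' + 2 * (D + s)) (A' \<union> Q')"
    using components_bounded_Un A'M pos by blast
  moreover have "{x \<in> ?C. (k x + j) div 4 = i} = A' \<union> Q'" by (auto simp: A'_def Q'_def)
  ultimately show "components_bounded d s (D' + 2 * (D + s)) {x \<in> ?C. (k x + j) div 4 = i}" by simp
qed

definition two_coloured :: "real \<Rightarrow> real \<Rightarrow> 'a set \<Rightarrow> bool" where
  "two_coloured s D A \<longleftrightarrow> (\<exists>E F. A = E \<union> F \<and> components_bounded d s D E \<and> components_bounded d s D F)"

text \<open>A theorem of Hurewicz type for maps to the line: fibres of dimension at most one yield a space of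
  dimension at most two. Colour the even bands with two colours at scale \<open>s\<close>, and split the odd bands
  into two parts at the scale \<open>D + 2 * s\<close>, where \<open>D\<close> bounds the pieces of the even bands. One part of
  each odd band receives the third colour. The other part is absorbed into the first or the second
  colour, alternately, so that for each of these two colours a piece of an even band meets absorbed
  pieces on one side only, and no long chain across the bands arises.\<close>

lemma asdim_le_2_bands:
  fixes f :: "'a \<Rightarrow> real"
  assumes f: "\<And>x. x \<in> M \<Longrightarrow> f x \<ge> 0" "\<And>x y. x \<in> M \<Longrightarrow> y \<in> M \<Longrightarrow> f x \<le> f y + d x y"
    and bands: "\<And>w s. w > 0 \<Longrightarrow> s > 0 \<Longrightarrow> \<exists>D. \<forall>a\<ge>0. two_coloured s D {x \<in> M. a \<le> f x \<and> f x < a + w}"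
  shows "asdim_le M d 2"
proof (rule asdim_le_2I)
  fix s :: real assume s: "s > 0"
  \<comment> \<open>With bands of width \<open>s\<close>, a step of length at most \<open>s\<close> changes the index of the band by at most one.\<close>
  define w where "w = s"
  have w: "w > 0" using s by (simp add: w_def)
  define k where "k x = nat \<lfloor>f x / w\<rfloor>" for x
  have k_eq: "{x \<in> M. k x = n} = {x \<in> M. real n * w \<le> f x \<and> f x < real n * w + w}" for n
  proof -
    have "k x = n \<longleftrightarrow> real n * w \<le> f x \<and> f x < real n * w + w" if "x \<in> M" for x
    proof -
      have "0 \<le> \<lfloor>f x / w\<rfloor>" using f(1)[OF that] w by simp
      then have "k x = n \<longleftrightarrow> \<lfloor>f x / w\<rfloor> = int n" by (auto simp: k_def)
      also have "\<dots> \<longleftrightarrow> real n \<le> f x / w \<and> f x / w < real n + 1" by (simp add: floor_eq_iff)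
      also have "\<dots> \<longleftrightarrow> real n * w \<le> f x \<and> f x < real n * w + w"
        using w by (simp add: field_simps)
      finally show ?thesis .
    qed
    then show ?thesis by auto
  qed
  have k: "k x \<le> k y + 1" if "x \<in> M" "y \<in> M" "d x y \<le> s" for x y
  proof -
    have "f x / w \<le> f y / w + 1" using f(2)[OF that(1,2)] that(3) w by (simp add: w_def field_simps)
    then have "\<lfloor>f x / w\<rfloor> \<le> \<lfloor>f y / w\<rfloor> + 1" by linarith
    moreover have "0 \<le> \<lfloor>f y / w\<rfloor>" using f(1)[OF that(2)] w by simp
    ultimately show ?thesis by (simp add: k_def nat_le_iff)
  qed
  have bands': "\<exists>D\<ge>0. \<forall>n. two_coloured s' D {x \<in> M. k x = n}" if s': "s' > 0" for s'
  proof -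
    obtain D where D: "\<forall>a\<ge>0. two_coloured s' D {x \<in> M. a \<le> f x \<and> f x < a + w}"
      using bands[OF w s'] by auto
    have "two_coloured s' (max D 0) {x \<in> M. k x = n}" for n
    proof -
      have "two_coloured s' D {x \<in> M. k x = n}" unfolding k_eq using D w by simp
      then show ?thesis unfolding two_coloured_def
        by (meson components_bounded_mono max.cobounded1 order_refl)
    qed
    then show ?thesis by (intro exI[of _ "max D 0"]) auto
  qed
  obtain D where D: "D \<ge> 0" "\<And>n. two_coloured s D {x \<in> M. k x = n}" using bands'[OF s] by auto
  obtain D' where D': "D' \<ge> 0" "\<And>n. two_coloured (D + 2 * s) D' {x \<in> M. k x = n}"
    using bands'[of "D + 2 * s"] D s by auto
  obtain E F where EF: "\<And>n. {x \<in> M. k x = n} = E n \<union> F n"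
    "\<And>n. components_bounded d s D (E n)" "\<And>n. components_bounded d s D (F n)"
    using D(2) unfolding two_coloured_def by metis
  obtain G H where GH: "\<And>n. {x \<in> M. k x = n} = G n \<union> H n"
    "\<And>n. components_bounded d (D + 2 * s) D' (G n)" "\<And>n. components_bounded d (D + 2 * s) D' (H n)"
    using D'(2) unfolding two_coloured_def by metis
  define C where "C i = (if i = 0 then (\<Union>n\<in>{n. even n}. E n) \<union> (\<Union>n\<in>{n. (n + 0) mod 4 = 1}. H n)
    else if i = 1 then (\<Union>n\<in>{n. even n}. F n) \<union> (\<Union>n\<in>{n. (n + 2) mod 4 = 1}. H n)
    else (\<Union>n\<in>{n. odd n}. G n))" for i :: nat
  let ?D = "D' + 2 * (D + s)"
  have three: "i < 3 \<longleftrightarrow> i = 0 \<or> i = 1 \<or> i = 2" for i :: nat by auto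
  have C0: "components_bounded d s ?D (C 0)" "components_bounded d s ?D (C 1)"
  proof -
    have sub: "E n \<subseteq> {x \<in> M. k x = n}" "F n \<subseteq> {x \<in> M. k x = n}" "H n \<subseteq> {x \<in> M. k x = n}" for n
      using EF(1)[of n] GH(1)[of n] by blast+
    have "s \<ge> 0" using s by simp
    note block = components_bounded_block[of _ k s D H D', OF _ _ sub(3) GH(3) k this D(1) D'(1)]
    show "components_bounded d s ?D (C 0)"
      unfolding C_def if_P[OF refl] by (rule block) (use sub EF in auto)
    have "C 1 = (\<Union>n\<in>{n. even n}. F n) \<union> (\<Union>n\<in>{n. (n + 2) mod 4 = 1}. H n)"
      unfolding C_def by simp
    then show "components_bounded d s ?D (C 1)"
      by (simp only:) (rule block, use sub EF in auto)
  qed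
  have G: "x \<in> M \<and> k x = n" if "x \<in> G n" for x n using GH(1)[of n] that by blast
  have C2_eq: "C 2 = (\<Union>n\<in>{n. odd n}. G n)" by (simp add: C_def)
  have C2: "components_bounded d s ?D (C 2)"
  proof (rule components_bounded_label[where g = k])
    fix n
    have "{x \<in> C 2. k x = n} \<subseteq> G n" unfolding C2_eq using G by blast
    then show "components_bounded d s ?D {x \<in> C 2. k x = n}"
      by (rule components_bounded_mono[OF GH(2)]) (use D D' s in auto)
  next
    fix x y assume xy: "x \<in> C 2" "y \<in> C 2" "d x y \<le> s"
    then have "x \<in> M" "odd (k x)" "y \<in> M" "odd (k y)" unfolding C2_eq using G by blast+
    moreover from this have "k x \<le> k y + 1" "k y \<le> k x + 1" using k[of x y] k[of y x] xy by (auto simp: commute)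
    ultimately show "k x = k y" by presburger
  qed
  have "M = C 0 \<union> C 1 \<union> C 2"
  proof
    have "E n \<subseteq> M" "F n \<subseteq> M" "G n \<subseteq> M" "H n \<subseteq> M" for n using EF(1)[of n] GH(1)[of n] by blast+
    then show "C 0 \<union> C 1 \<union> C 2 \<subseteq> M" unfolding C_def by (simp add: UN_subset_iff)
    show "M \<subseteq> C 0 \<union> C 1 \<union> C 2"
    proof
      fix x assume "x \<in> M"
      then have x: "x \<in> E (k x) \<union> F (k x)" "x \<in> G (k x) \<union> H (k x)"
        using EF(1)[of "k x"] GH(1)[of "k x"] by blast+
      have "even (k x) \<or> (k x + 0) mod 4 = 1 \<or> (k x + 2) mod 4 = 1" by presburger
      then show "x \<in> C 0 \<union> C 1 \<union> C 2"
      proof (elim disjE)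
        assume "even (k x)"
        then show ?thesis using x(1) unfolding C_def by auto
      next
        assume "(k x + 0) mod 4 = 1"
        then have "odd (k x)" by presburger
        then show ?thesis using x(2) \<open>(k x + 0) mod 4 = 1\<close> unfolding C_def by auto
      next
        assume "(k x + 2) mod 4 = 1"
        then have "odd (k x)" by presburger
        then show ?thesis using x(2) \<open>(k x + 2) mod 4 = 1\<close> unfolding C_def by auto
      qed
    qed
  qed
  then have "M = (\<Union>i<3. C i)" by (auto simp: three)
  moreover have "\<forall>i<3. components_bounded d s ?D (C i)" using C0 C2 three by auto
  ultimately show "\<exists>C D. M = (\<Union>i<3::nat. C i) \<and> (\<forall>i<3. components_bounded d s D (C i))" by blast
qed

end

text \<open>Moving every point by at most \<open>c\<close> changes scales and bounds by at most \<open>2 * c\<close>.\<close>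

lemma two_coloured_vimage:
  assumes MS: "Metric_space M d" and S: "Metric_space.two_coloured d (s + 2 * c) D S"
    and A: "A \<subseteq> M" and h: "\<And>x. x \<in> A \<Longrightarrow> h x \<in> S" "\<And>x. x \<in> A \<Longrightarrow> d x (h x) \<le> c" and SM: "S \<subseteq> M"
  shows "Metric_space.two_coloured d s (D + 2 * c) A"
proof -
  interpret Metric_space M d by (rule MS)
  obtain E F where EF: "S = E \<union> F" "components_bounded d (s + 2 * c) D E" "components_bounded d (s + 2 * c) D F"
    using S unfolding two_coloured_def by blast
  have pull: "components_bounded d s (D + 2 * c) {x \<in> A. h x \<in> G}" if G: "components_bounded d (s + 2 * c) D G" for G
    unfolding components_bounded_def
  proof (intro allI impI)
    fix x y assume ch: "chain (\<lambda>a b. d a b \<le> s) {x \<in> A. h x \<in> G} x y"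
    have M: "a \<in> M" "h a \<in> M" if "a \<in> A" for a using that A h(1)[OF that] SM by blast+
    have "chain (\<lambda>a b. d a b \<le> s + 2 * c) G (h x) (h y)"
    proof (rule chain_map[OF ch])
      fix a b assume ab: "a \<in> {x \<in> A. h x \<in> G}" "b \<in> {x \<in> A. h x \<in> G}" "d a b \<le> s"
      then have "a \<in> A" "b \<in> A" by auto
      then show "d (h a) (h b) \<le> s + 2 * c"
        using triangle[of "h a" a "h b"] triangle[of a b "h b"] M[of a] M[of b] h(2)[of a] h(2)[of b] ab(3)
          commute[of "h a" a] by linarith
    qed simp
    then have "d (h x) (h y) \<le> D" using G by (simp add: components_bounded_def)
    moreover have "x \<in> A" "y \<in> A" using chain_start[OF ch] chain_end[OF ch] by auto
    ultimately show "d x y \<le> D + 2 * c"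
      using triangle[of x "h x" y] triangle[of "h x" "h y" y] M[of x] M[of y] h(2)[of x] h(2)[of y]
        commute[of "h y" y] by linarith
  qed
  have "A = {x \<in> A. h x \<in> E} \<union> {x \<in> A. h x \<in> F}" using h(1) EF(1) by blast
  then show ?thesis unfolding two_coloured_def using pull EF by blast
qed

section \<open>Strictly convex curves in the plane\<close>

text \<open>Two cevians of a triangle meet.\<close>

lemma cevians_meet:
  fixes q b c :: "'a::real_vector"
  assumes z: "z \<in> closed_segment q b" and z': "z' \<in> closed_segment q c"
  shows "closed_segment z c \<inter> closed_segment b z' \<noteq> {}"
proof -
  obtain x where x: "0 \<le> x" "x \<le> 1" "z = (1 - x) *\<^sub>R q + x *\<^sub>R b" using z by (auto simp: in_segment)
  obtain y where y: "0 \<le> y" "y \<le> 1" "z' = (1 - y) *\<^sub>R q + y *\<^sub>R c" using z' by (auto simp: in_segment)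
  have "\<exists>t. 0 \<le> t \<and> t \<le> 1 \<and> (1 - t * y) * x = 1 - t"
  proof (cases "x * y = 1")
    case True
    then have "x = 1" using x y by (metis mult.commute mult_left_le mult.right_neutral order_antisym)
    then show ?thesis by (intro exI[of _ 0]) auto
  next
    case False
    moreover have "x * y \<le> 1" using x y by (simp add: mult_le_one)
    ultimately have xy: "x * y < 1" by simp
    define t where "t = (1 - x) / (1 - x * y)"
    have "x * y \<le> x" using x y by (simp add: mult_left_le)
    then have "0 \<le> t" "t \<le> 1" using x xy by (simp_all add: t_def)
    moreover have "t * (1 - x * y) = 1 - x" using xy by (simp add: t_def)
    then have "(1 - t * y) * x = 1 - t" by (simp add: algebra_simps)
    ultimately show ?thesis by blast
  qed
  then obtain t where t: "0 \<le> t" "t \<le> 1" "(1 - t * y) * x = 1 - t" by blast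
  have ty: "0 \<le> t * y" "t * y \<le> 1" using t y by (simp_all add: mult_le_one)
  have "(1 - t * y) *\<^sub>R z + (t * y) *\<^sub>R c
      = ((1 - t * y) - (1 - t * y) * x) *\<^sub>R q + ((1 - t * y) * x) *\<^sub>R b + (t * y) *\<^sub>R c"
    unfolding x(3) by (simp add: algebra_simps)
  also have "\<dots> = (1 - t) *\<^sub>R b + t *\<^sub>R z'"
    unfolding t(3) y(3) by (simp add: algebra_simps)
  finally have "(1 - t * y) *\<^sub>R z + (t * y) *\<^sub>R c = (1 - t) *\<^sub>R b + t *\<^sub>R z'" .
  moreover have "(1 - t * y) *\<^sub>R z + (t * y) *\<^sub>R c \<in> closed_segment z c"
    using ty unfolding in_segment by blast
  moreover have "(1 - t) *\<^sub>R b + t *\<^sub>R z' \<in> closed_segment b z'"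
    using t unfolding in_segment by blast
  ultimately show ?thesis by auto
qed

text \<open>A line separating \<open>q\<close> from \<open>C\<close> touches \<open>S\<close> in \<open>q\<close> only, since the midpoint of \<open>q\<close> and any other
  point of \<open>S\<close> lies in the open set \<open>C\<close>.\<close>

lemma supporting_line:
  fixes C S :: "'a::euclidean_space set"
  assumes "open C" "convex C" and disj: "S \<inter> C = {}"
    and seg: "\<And>p p'. p \<in> S \<Longrightarrow> p' \<in> S \<Longrightarrow> p \<noteq> p' \<Longrightarrow> open_segment p p' \<subseteq> C"
    and q: "q \<in> S"
  obtains n where "n \<noteq> 0" "\<And>p. p \<in> S \<Longrightarrow> p \<noteq> q \<Longrightarrow> n \<bullet> p < n \<bullet> q"
proof (cases "C = {}")
  case True
  obtain n :: 'a where "n \<noteq> 0" using nonzero_Basis nonempty_Basis by blast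
  moreover have "p = q" if "p \<in> S" for p using seg[OF that q] True by auto
  ultimately show ?thesis using that by blast
next
  case False
  obtain n b where n: "n \<noteq> 0" "\<forall>x\<in>C. n \<bullet> x \<le> b" "\<forall>x\<in>{q}. n \<bullet> x \<ge> b"
    using separating_hyperplane_sets[of C "{q}"] assms False by auto
  have less: "n \<bullet> x < b" if x: "x \<in> C" for x
  proof -
    obtain e where e: "e > 0" "cball x e \<subseteq> C" using \<open>open C\<close> x open_contains_cball by metis
    have "x + (e / norm n) *\<^sub>R n \<in> cball x e" using n e by (simp add: dist_norm)
    then have "n \<bullet> (x + (e / norm n) *\<^sub>R n) \<le> b" using n e by blast
    moreover have "0 < (e / norm n) * (n \<bullet> n)" using n e by simp
    ultimately show ?thesis by (simp add: inner_add_right)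
  qed
  have "n \<bullet> p < n \<bullet> q" if "p \<in> S" "p \<noteq> q" for p
  proof -
    have "midpoint p q \<in> C" using seg[OF that(1) q that(2)] that(2) by (auto simp: midpoint_in_open_segment)
    then have "n \<bullet> midpoint p q < n \<bullet> q" using less n by fastforce
    then show ?thesis by (simp add: midpoint_def inner_add_right)
  qed
  with n(1) that show ?thesis by blast
qed

text \<open>A projective map that sends the supporting line at \<open>q\<close> to infinity places \<open>S\<close> without \<open>q\<close> on
  the graph of a strictly convex function and makes the lines through \<open>q\<close> vertical. The order along the
  graph from left to right is the order by \<open>slope\<close>. Convexity says that for \<open>b\<close> between
  \<open>a\<close> and \<open>c\<close> the segment from \<open>a\<close> to \<open>c\<close> meets the segment from \<open>q\<close> to \<open>b\<close>; two instances of this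
  and the cevians of the triangle \<open>q b c\<close> give the crossing of arbitrary interlaced chords.\<close>

lemma slope_order:
  fixes C S :: "(real ^ 2) set"
  assumes "open C" "convex C" and disj: "S \<inter> C = {}"
    and seg: "\<And>p p'. p \<in> S \<union> C \<Longrightarrow> p' \<in> S \<union> C \<Longrightarrow> p \<noteq> p' \<Longrightarrow> open_segment p p' \<subseteq> C"
    and q: "q \<in> S"
  shows "\<exists>u :: real ^ 2 \<Rightarrow> real. inj_on u S \<and> (\<forall>x\<in>S. u q \<le> u x) \<and>
    (\<forall>a\<in>S. \<forall>b\<in>S. \<forall>c\<in>S. \<forall>e\<in>S. u a < u b \<longrightarrow> u b < u c \<longrightarrow> u c < u e \<longrightarrow>
      closed_segment a c \<inter> closed_segment b e \<noteq> {})"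
proof -
  obtain n where n: "n \<noteq> 0" "\<And>p. p \<in> S \<Longrightarrow> p \<noteq> q \<Longrightarrow> n \<bullet> p < n \<bullet> q"
    by (rule supporting_line[of C S q]) (use assms in auto)
  define m :: "real ^ 2" where "m = (\<chi> i. if i = 1 then - (n $ 2) else n $ 1)"
  have zero: "x = 0" if "n \<bullet> x = 0" "m \<bullet> x = 0" for x
  proof -
    have e: "n $ 1 * x $ 1 + n $ 2 * x $ 2 = 0" "n $ 1 * x $ 2 = n $ 2 * x $ 1"
      using that by (simp_all add: inner_vec_def sum_2 m_def)
    have nn: "n $ 1 * n $ 1 + n $ 2 * n $ 2 \<noteq> 0"
      using n(1) by (auto simp: vec_eq_iff forall_2 sum_squares_eq_zero_iff)
    have "x $ 1 * (n $ 1 * n $ 1 + n $ 2 * n $ 2) = 0" "x $ 2 * (n $ 1 * n $ 1 + n $ 2 * n $ 2) = 0"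
      using e by algebra+
    then show ?thesis using nn by (auto simp: vec_eq_iff forall_2)
  qed
  \<comment> \<open>\<open>(slope v, 1 / k v)\<close> are the coordinates of the image of \<open>v\<close> under a projective map that sends
    the supporting line \<open>k = 0\<close> to infinity.\<close>
  define k where "k v = n \<bullet> (q - v)" for v
  define slope where "slope v = m \<bullet> (v - q) / k v" for v
  have k: "k v > 0" if "v \<in> S" "v \<noteq> q" for v using n(2)[OF that] by (simp add: k_def inner_diff_right)
  have X: "m \<bullet> (v - q) = k v * slope v" if "v \<in> S" "v \<noteq> q" for v using k[OF that] by (simp add: slope_def)
  have eqI: "v - q = t *\<^sub>R (w - q)" if "k v = t * k w" "m \<bullet> (v - q) = t * (m \<bullet> (w - q))" for v w t
  proof -
    have "n \<bullet> (v - q - t *\<^sub>R (w - q)) = 0" "m \<bullet> (v - q - t *\<^sub>R (w - q)) = 0"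
      using that by (simp_all add: k_def inner_diff_right algebra_simps)
    from zero[OF this] show ?thesis by simp
  qed
  \<comment> \<open>strict convexity: from \<open>q\<close>, no point of \<open>S\<close> is hidden behind another point of \<open>S \<union> C\<close>\<close>
  have visible: "t \<le> 1" if "z \<in> S \<union> C" "b \<in> S" "b \<noteq> q" "z - q = t *\<^sub>R (b - q)" for z b t
  proof (rule ccontr)
    assume "\<not> t \<le> 1"
    then have t: "t > 1" by simp
    have "b = (1 - 1/t) *\<^sub>R q + (1/t) *\<^sub>R z"
    proof -
      have "(1/t) *\<^sub>R (z - q) = b - q" using that(4) t by simp
      then show ?thesis by (simp add: algebra_simps)
    qed
    moreover have "z \<noteq> q" using that t by auto
    ultimately have "b \<in> open_segment q z" unfolding in_segment using t by (intro conjI exI[of _ "1/t"]) auto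
    then have "b \<in> C" using seg[of q z] q that \<open>z \<noteq> q\<close> by auto
    then show False using that disj by auto
  qed
  have triple: "\<exists>z. z \<in> closed_segment a c \<and> z \<in> closed_segment q b"
    if S: "a \<in> S" "b \<in> S" "c \<in> S" and ne: "a \<noteq> q" "b \<noteq> q" "c \<noteq> q"
      and less: "slope a < slope b" "slope b < slope c" for a b c
  proof -
    define t where "t = (slope b - slope a) / (slope c - slope a)"
    have t: "0 < t" "t < 1" using less by (auto simp: t_def)
    have sb: "slope b = (1 - t) * slope a + t * slope c"
    proof -
      have "t * (slope c - slope a) = slope b - slope a" using less by (simp add: t_def)
      then show ?thesis by (simp add: algebra_simps)
    qed
    \<comment> \<open>The point \<open>z\<close> of the segment from \<open>a\<close> to \<open>c\<close> that is seen from \<open>q\<close> with the slope of \<open>b\<close>.\<close>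
    define D where "D = (1 - t) * k c + t * k a"
    have pos: "k a > 0" "k b > 0" "k c > 0" using k S ne by auto
    then have D: "D > 0" using t by (simp add: D_def add_pos_pos)
    define s where "s = t * k a / D"
    have s: "0 < s" "s < 1" using t pos D by (auto simp: s_def D_def add_pos_pos)
    have "((1 - t) * k c + t * k a) / D = 1" using D unfolding D_def by simp
    then have s1: "1 - s = (1 - t) * k c / D" by (simp add: s_def add_divide_distrib)
    define z where "z = (1 - s) *\<^sub>R a + s *\<^sub>R c"
    have "a \<noteq> c" using less by auto
    then have zo: "z \<in> open_segment a c" unfolding in_segment z_def using s by blast
    then have zC: "z \<in> S \<union> C" using seg[of a c] S \<open>a \<noteq> c\<close> by auto
    have zq: "z - q = (1 - s) *\<^sub>R (a - q) + s *\<^sub>R (c - q)" by (simp add: z_def algebra_simps)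
    have w1: "(1 - s) * k a = (1 - t) * (k a * k c / D)" unfolding s1 by simp
    have w2: "s * k c = t * (k a * k c / D)" by (simp add: s_def)
    have "k z = n \<bullet> (- (z - q))" by (simp add: k_def)
    also have "\<dots> = (1 - s) * k a + s * k c" unfolding zq by (simp add: k_def inner_diff_right inner_add_right algebra_simps)
    also have "\<dots> = k a * k c / D" unfolding w1 w2 by (simp only: distrib_right[symmetric]) simp
    finally have kz: "k z = k a * k c / D" .
    have "m \<bullet> (z - q) = (1 - s) * (k a * slope a) + s * (k c * slope c)"
      unfolding zq inner_add_right inner_scaleR_right X[OF S(1) ne(1)] X[OF S(3) ne(3)] ..
    also have "\<dots> = ((1 - s) * k a) * slope a + (s * k c) * slope c" by simp
    also have "\<dots> = k z * slope b" unfolding w1 w2 kz[symmetric] sb by (simp add: algebra_simps)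
    finally have mz: "m \<bullet> (z - q) = k z * slope b" .
    define r where "r = k z / k b"
    have r0: "r \<ge> 0" using pos D by (simp add: r_def kz)
    have zb: "z - q = r *\<^sub>R (b - q)"
      by (rule eqI) (use pos in \<open>simp_all add: r_def mz X[OF S(2) ne(2)]\<close>)
    then have "r \<le> 1" using visible[OF zC S(2) ne(2)] by simp
    moreover have "z = (1 - r) *\<^sub>R q + r *\<^sub>R b"
      using zb by (simp add: algebra_simps)
    ultimately have "z \<in> closed_segment q b" using r0 unfolding in_segment by blast
    moreover have "z \<in> closed_segment a c" using zo open_closed_segment by blast
    ultimately show ?thesis by blast
  qed
  \<comment> \<open>The value at \<open>q\<close> has to be below \<open>- pi / 2\<close>, the infimum of \<open>arctan\<close>.\<close>
  define u where "u v = (if v = q then -2 else arctan (slope v))" for v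
  have u_gt: "-2 < arctan x" for x using arctan_lbound[of x] pi_less_4 by linarith
  have "inj_on u S"
  proof (rule inj_onI)
    fix v w assume vw: "v \<in> S" "w \<in> S" "u v = u w"
    have "v = w" if ne: "v \<noteq> q" "w \<noteq> q"
    proof -
      have sl: "slope v = slope w" using vw ne by (simp add: u_def arctan_eq_iff)
      have pos: "k v > 0" "k w > 0" using k vw ne by auto
      have "v - q = (k v / k w) *\<^sub>R (w - q)" "w - q = (k w / k v) *\<^sub>R (v - q)"
        by (rule eqI, use pos in \<open>simp_all add: X[OF vw(1) ne(1)] X[OF vw(2) ne(2)] sl\<close>)+
      then have "k v / k w \<le> 1" "k w / k v \<le> 1" using visible vw ne by blast+
      then have "k v / k w = 1" using pos by (simp add: field_simps)
      then show ?thesis using \<open>v - q = (k v / k w) *\<^sub>R (w - q)\<close> by simp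
    qed
    moreover have "v = q \<longleftrightarrow> w = q" using vw(3) u_gt[of "slope v"] u_gt[of "slope w"] by (auto simp: u_def split: if_splits)
    ultimately show "v = w" by blast
  qed
  moreover have min: "u q \<le> u x" for x using u_gt[of "slope x"] by (simp add: u_def)
  moreover have "closed_segment a c \<inter> closed_segment b e \<noteq> {}"
    if S: "a \<in> S" "b \<in> S" "c \<in> S" "e \<in> S" and less: "u a < u b" "u b < u c" "u c < u e" for a b c e
  proof -
    have ne: "b \<noteq> q" "c \<noteq> q" "e \<noteq> q"
      using less min[of a] min[of b] min[of c] by auto
    have sl: "slope b < slope c" "slope c < slope e" using less ne by (auto simp: u_def arctan_less_iff)
    obtain z' where z': "z' \<in> closed_segment b e" "z' \<in> closed_segment q c"
      using triple[OF S(2,3,4) ne sl] by blast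
    show ?thesis
    proof (cases "a = q")
      case True
      then show ?thesis using z' by auto
    next
      case False
      then have "slope a < slope b" using less ne by (auto simp: u_def arctan_less_iff)
      then obtain z where z: "z \<in> closed_segment a c" "z \<in> closed_segment q b"
        using triple[OF S(1,2,3) False ne(1,2) _ sl(1)] by blast
      have "closed_segment z c \<subseteq> closed_segment a c" "closed_segment b z' \<subseteq> closed_segment b e"
        using z z' by (simp_all add: subset_closed_segment)
      then show ?thesis using cevians_meet[OF z(2) z'(2)] by blast
    qed
  qed
  ultimately show ?thesis by (intro exI[of _ u]) blast
qed

context convex_domain
begin

text \<open>Each component of \<open>S\<close> at scale \<open>s\<close> gets a root, from which the levels are counted. Neighbouring
  points have levels that differ by at most one, so a chain of points with levels of the same parity
  stays on one level, and \<open>level_component_bounded\<close> applies.\<close>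

lemma two_coloured_ordered_set:
  assumes S: "S \<subseteq> X" and s: "s > 0"
    and order: "\<And>q. q \<in> S \<Longrightarrow> \<exists>u :: 'a \<Rightarrow> real. inj_on u S \<and> (\<forall>x\<in>S. u q \<le> u x) \<and>
      (\<forall>a\<in>S. \<forall>b\<in>S. \<forall>c\<in>S. \<forall>e\<in>S. u a < u b \<longrightarrow> u b < u c \<longrightarrow> u c < u e \<longrightarrow>
        closed_segment a c \<inter> closed_segment b e \<noteq> {})"
  shows "H.two_coloured s (13 * s) S"
proof -
  define R where "R a b \<longleftrightarrow> a \<in> S \<and> b \<in> S \<and> hilbert_dist X a b \<le> s" for a b
  have symR: "symp R" by (auto simp: R_def symp_def H.commute)
  have graph: "\<exists>u. crossing_graph S R u q" if "q \<in> S" for q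
  proof -
    from order[OF that] obtain u :: "'a \<Rightarrow> real" where u: "inj_on u S" "\<And>x. x \<in> S \<Longrightarrow> u q \<le> u x"
      "\<And>a b c e. a \<in> S \<Longrightarrow> b \<in> S \<Longrightarrow> c \<in> S \<Longrightarrow> e \<in> S \<Longrightarrow> u a < u b \<Longrightarrow> u b < u c \<Longrightarrow> u c < u e \<Longrightarrow>
        closed_segment a c \<inter> closed_segment b e \<noteq> {}" by blast
    have "crossing_graph S R u q"
    proof
      show "symp R" by (rule symR)
      show "R x x" if "x \<in> S" for x using that S s by (auto simp: R_def)
      show "x \<in> S \<and> y \<in> S" if "R x y" for x y using that by (simp add: R_def)
      show "inj_on u S" "q \<in> S" "\<And>x. x \<in> S \<Longrightarrow> u q \<le> u x" by fact+
      fix a b c e assume r: "R a c" "R b e" and less: "u a < u b" "u b < u c" "u c < u e"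
      then have in_S: "a \<in> S" "b \<in> S" "c \<in> S" "e \<in> S" by (auto simp: R_def)
      have "hilbert_dist X a b \<le> s \<or> hilbert_dist X c e \<le> s"
        by (rule crossing_segments_short_side) (use in_S S u(3)[OF in_S less] r in \<open>auto simp: R_def\<close>)
      then show "R a b \<or> R c e" using in_S by (auto simp: R_def)
    qed
    then show ?thesis by (intro exI[of _ u])
  qed
  \<comment> \<open>The choice depends only on the set of candidates, so all points of a component get the same root.\<close>
  define root where "root x = (SOME q. chain R S q x)" for x
  have root: "chain R S (root x) x" if "x \<in> S" for x
    unfolding root_def by (rule someI[of _ x]) (rule chain_refl[OF that])
  have reach: "\<exists>n. (R ^^ n) q x" if "chain R S q x" for q x
    using that
  proof (induction rule: chain_induct)
    case refl
    show ?case by (intro exI[of _ 0]) simp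
  next
    case (step y z)
    then obtain n where "(R ^^ n) q y" by blast
    then have "(R ^^ Suc n) q z" using step by auto
    then show ?case by blast
  qed
  have root_eq: "root x = root y" if "R x y" for x y
  proof -
    have "x \<in> S" "y \<in> S" using that by (auto simp: R_def)
    then have "chain R S q x \<longleftrightarrow> chain R S q y" for q
      using chain_step[of R S q x y] chain_step[of R S q y x] that symR by (auto dest: sympD)
    then show ?thesis unfolding root_def by presburger
  qed
  define l where "l x = bfs_level R (root x) x" for x
  have l_step: "l y \<le> Suc (l x)" if "R x y" for x y
  proof -
    have "x \<in> S" using that by (simp add: R_def)
    from reach[OF root[OF this]] obtain n where "(R ^^ n) (root x) x" by blast
    from bfs_level_step[OF that this] show ?thesis by (simp add: l_def root_eq[OF that])
  qed
  have len: "y \<in> S \<and> hilbert_dist X x y \<le> real n * s" if x: "x \<in> S" and "(R ^^ n) x y" for n x y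
    using that(2)
  proof (induction n arbitrary: y)
    case 0
    then show ?case using x S by auto
  next
    case (Suc n)
    then obtain w where w: "(R ^^ n) x w" "R w y" by auto
    have wS: "w \<in> S" "hilbert_dist X x w \<le> real n * s" using Suc.IH[OF w(1)] by blast+
    have yS: "y \<in> S" "hilbert_dist X w y \<le> s" using w(2) by (simp_all add: R_def)
    have "hilbert_dist X x y \<le> hilbert_dist X x w + hilbert_dist X w y"
      using H.triangle[OF subsetD[OF S x] subsetD[OF S wS(1)] subsetD[OF S yS(1)]] .
    with wS yS show ?case by (simp add: algebra_simps)
  qed
  have bounded: "components_bounded (hilbert_dist X) s (13 * s) {x \<in> S. even (l x) = par}" for par
    unfolding components_bounded_def
  proof (intro allI impI)
    fix x y
    let ?E = "{x \<in> S. even (l x) = par}"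
    assume "chain (\<lambda>a b. hilbert_dist X a b \<le> s) ?E x y"
    then have ch: "chain R ?E x y"
      by (rule chain_map[where h = "\<lambda>x. x", simplified]) (auto simp: R_def)
    then have xS: "x \<in> S" using chain_start by fastforce
    let ?g = "\<lambda>x. (root x, l x)"
    have "?g a = ?g b" if ab: "a \<in> ?E" "b \<in> ?E" "R a b" for a b
    proof -
      have "R b a" using ab symR by (auto dest: sympD)
      then have "l a = l b" using l_step[of a b] l_step[of b a] ab by (auto simp: le_Suc_eq)
      then show ?thesis using root_eq[OF ab(3)] by simp
    qed
    then have ch2: "chain R {z \<in> ?E. ?g z = ?g x} x y" by (rule chain_const[OF ch])
    have rS: "root x \<in> S" using chain_start[OF root[OF xS]] .
    obtain u where "crossing_graph S R u (root x)" using graph[OF rS] by blast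
    then interpret crossing_graph S R u "root x" .
    have "chain R (level_set (l x)) x y"
    proof (rule chain_mono[OF ch2])
      show "{z \<in> ?E. ?g z = ?g x} \<subseteq> level_set (l x)"
      proof
        fix z assume "z \<in> {z \<in> ?E. ?g z = ?g x}"
        then have z: "z \<in> S" "root z = root x" "l z = l x" by auto
        obtain n where "(R ^^ n) (root z) z" using reach[OF root[OF z(1)]] by blast
        from bfs_level_relpowp[OF this] show "z \<in> level_set (l x)" using z by (simp add: level_set_def l_def)
      qed
    qed
    from level_component_bounded[OF this] obtain n where n: "n \<le> 13" "(R ^^ n) x y"
      by (auto simp: within_steps_def)
    have "hilbert_dist X x y \<le> real n * s" using len[OF xS n(2)] by simp
    also have "\<dots> \<le> 13 * s" using n s by simp
    finally show "hilbert_dist X x y \<le> 13 * s" .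
  qed
  have "S = {x \<in> S. even (l x) = True} \<union> {x \<in> S. even (l x) = False}" by auto
  then show ?thesis unfolding H.two_coloured_def using bounded by blast
qed

end

section \<open>The Minkowski functional at a base point\<close>

locale pointed_convex_domain = convex_domain +
  fixes p :: 'a
  assumes p_X: "p \<in> X"
begin

text \<open>The Minkowski functional (gauge) of \<open>X\<close> translated by \<open>- p\<close>.\<close>

definition minkowski :: "'a \<Rightarrow> real" where
  "minkowski v = Inf {t. 0 < t \<and> p + (1/t) *\<^sub>R v \<in> X}"

definition inradius :: real where
  "inradius = (SOME r. 0 < r \<and> cball p r \<subseteq> X)"

definition outradius :: real where
  "outradius = (SOME r. 0 < r \<and> closure X \<subseteq> cball p r)"

lemma inradius: "inradius > 0" "cball p inradius \<subseteq> X"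
proof -
  have "\<exists>r>0. cball p r \<subseteq> X" using open_X p_X open_contains_cball by blast
  from someI_ex[OF this] show "inradius > 0" "cball p inradius \<subseteq> X"
    by (auto simp: inradius_def)
qed

lemma outradius: "outradius > 0" "closure X \<subseteq> cball p outradius"
proof -
  have "bounded (closure X)" using bounded_X bounded_closure by blast
  then have "\<exists>r. 0 < r \<and> closure X \<subseteq> cball p r"
    using bounded_subset_ballD[of "closure X" p] ball_subset_cball by blast
  from someI_ex[OF this] show "outradius > 0" "closure X \<subseteq> cball p outradius"
    by (auto simp: outradius_def)
qed

lemma add_in_X: "norm v \<le> inradius \<Longrightarrow> p + v \<in> X"
  using inradius(2) by (auto simp: dist_norm)

lemma minkowski_less_iff:
  assumes t: "t > 0"
  shows "minkowski v < t \<longleftrightarrow> p + (1/t) *\<^sub>R v \<in> X"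
proof
  let ?A = "{t. 0 < t \<and> p + (1/t) *\<^sub>R v \<in> X}"
  have bdd: "bdd_below ?A" by (rule bdd_belowI[of _ 0]) auto
  have ne: "?A \<noteq> {}"
  proof -
    define t where "t = (norm v + 1) / inradius"
    have "t > 0" using inradius by (simp add: t_def add_nonneg_pos)
    moreover have "norm ((1/t) *\<^sub>R v) \<le> inradius"
    proof -
      have "norm ((1/t) *\<^sub>R v) = norm v / t" using \<open>t > 0\<close> by simp
      also have "\<dots> = inradius * (norm v / (norm v + 1))" by (simp add: t_def)
      also have "\<dots> \<le> inradius * 1"
        using inradius by (intro mult_left_mono) (auto simp: divide_simps add_nonneg_pos)
      finally show ?thesis by simp
    qed
    ultimately have "t \<in> ?A" using add_in_X by blast
    then show ?thesis by blast
  qed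
  {
    assume "minkowski v < t"
    then obtain s where s: "0 < s" "p + (1/s) *\<^sub>R v \<in> X" "s < t"
      unfolding minkowski_def using cInf_lessD[OF ne] by blast
    have "(1 - s/t) *\<^sub>R p + (s/t) *\<^sub>R (p + (1/s) *\<^sub>R v) \<in> X"
      using s t p_X convex_X by (intro convexD) auto
    moreover have "(1 - s/t) *\<^sub>R p + (s/t) *\<^sub>R (p + (1/s) *\<^sub>R v) = p + (1/t) *\<^sub>R v"
      using s t by (simp add: algebra_simps)
    ultimately show "p + (1/t) *\<^sub>R v \<in> X" by simp
  next
    assume v: "p + (1/t) *\<^sub>R v \<in> X"
    then obtain e where e: "e > 0" "cball (p + (1/t) *\<^sub>R v) e \<subseteq> X" using open_X open_contains_cball by metis
    define d where "d = e / (norm v + 1)"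
    have d: "d > 0" "d * norm v \<le> e"
    proof -
      have pos: "0 < norm v + 1" by (simp add: add_nonneg_pos)
      then show "d > 0" using e by (simp add: d_def)
      have "d * norm v \<le> d * (norm v + 1)" using \<open>d > 0\<close> by simp
      also have "\<dots> = e" using pos by (simp add: d_def)
      finally show "d * norm v \<le> e" .
    qed
    define s where "s = 1 / (1/t + d)"
    have pos: "1/t + d > 0" using t d by (simp add: add_pos_pos)
    have "s > 0" using pos by (simp add: s_def)
    have "s < 1 / (1/t)" unfolding s_def using t d pos by (intro divide_strict_left_mono) auto
    then have "s < t" by simp
    have "p + (1/s) *\<^sub>R v = (p + (1/t) *\<^sub>R v) + d *\<^sub>R v"
      by (simp add: s_def scaleR_add_left)
    also have "\<dots> \<in> cball (p + (1/t) *\<^sub>R v) e" using d by (simp add: dist_norm)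
    finally have "p + (1/s) *\<^sub>R v \<in> X" using e by blast
    then have "minkowski v \<le> s" unfolding minkowski_def using \<open>s > 0\<close> bdd by (intro cInf_lower) auto
    then show "minkowski v < t" using \<open>s < t\<close> by simp
  }
qed

lemma minkowski_nonneg: "0 \<le> minkowski v"
proof (rule ccontr)
  assume neg: "\<not> 0 \<le> minkowski v"
  let ?A = "{t. 0 < t \<and> p + (1/t) *\<^sub>R v \<in> X}"
  from minkowski_less_iff[of 1 v] neg have "p + (1/1) *\<^sub>R v \<in> X" by simp
  then have "?A \<noteq> {}" using zero_less_one by blast
  then have "0 \<le> minkowski v" unfolding minkowski_def by (rule cInf_greatest) auto
  with neg show False ..
qed

lemma minkowski_leI:
  assumes "c \<ge> 0" "\<And>t. t > c \<Longrightarrow> p + (1/t) *\<^sub>R v \<in> X"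
  shows "minkowski v \<le> c"
proof (rule field_le_epsilon)
  fix e :: real assume "e > 0"
  then have "minkowski v < c + e" using minkowski_less_iff[of "c + e" v] assms by auto
  then show "minkowski v \<le> c + e" by simp
qed

lemma minkowski_in_X: "minkowski v < t \<Longrightarrow> p + (1/t) *\<^sub>R v \<in> X"
  using minkowski_less_iff[of t v] minkowski_nonneg[of v] by simp

lemma minkowski_less_1_iff: "minkowski (x - p) < 1 \<longleftrightarrow> x \<in> X"
  using minkowski_less_iff[of 1 "x - p"] by simp

lemma minkowski_zero [simp]: "minkowski 0 = 0"
  using minkowski_leI[of 0 0] p_X minkowski_nonneg[of 0] by simp

lemma minkowski_scaleR:
  assumes "c \<ge> 0"
  shows "minkowski (c *\<^sub>R v) = c * minkowski v"
proof (cases "c = 0")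
  case False
  then have c: "c > 0" using assms by simp
  have le: "minkowski (c *\<^sub>R v) \<le> c * minkowski v" if c: "c > 0" for c v
  proof (rule minkowski_leI)
    show "0 \<le> c * minkowski v" using c minkowski_nonneg by simp
    fix t assume "c * minkowski v < t"
    then have "minkowski v < t / c" using c by (simp add: pos_less_divide_eq mult.commute)
    from minkowski_in_X[OF this] show "p + (1/t) *\<^sub>R c *\<^sub>R v \<in> X" by simp
  qed
  have "minkowski v = minkowski ((1/c) *\<^sub>R (c *\<^sub>R v))" using c by simp
  also have "\<dots> \<le> (1/c) * minkowski (c *\<^sub>R v)" by (rule le) (use c in simp)
  finally have "c * minkowski v \<le> minkowski (c *\<^sub>R v)" using c by (simp add: field_simps)
  with le[OF c, of v] show ?thesis by simp
qed simp

lemma minkowski_triangle: "minkowski (v + w) \<le> minkowski v + minkowski w"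
proof (rule minkowski_leI)
  show "0 \<le> minkowski v + minkowski w" using minkowski_nonneg by (simp add: add_nonneg_nonneg)
  fix t assume t: "minkowski v + minkowski w < t"
  define e where "e = (t - (minkowski v + minkowski w)) / 2"
  define a b where "a = minkowski v + e" and "b = minkowski w + e"
  have e: "e > 0" using t by (simp add: e_def)
  have ab: "a > 0" "b > 0" "a + b = t"
    using e minkowski_nonneg[of v] minkowski_nonneg[of w] by (auto simp: a_def b_def e_def field_simps)
  have in_X: "p + (1/a) *\<^sub>R v \<in> X" "p + (1/b) *\<^sub>R w \<in> X"
    using e by (auto intro!: minkowski_in_X simp: a_def b_def)
  have t0: "t > 0" using ab by linarith
  have "a/t + b/t = 1" using ab t0 by (simp add: add_divide_distrib[symmetric])
  then have "(a/t) *\<^sub>R (p + (1/a) *\<^sub>R v) + (b/t) *\<^sub>R (p + (1/b) *\<^sub>R w) \<in> X"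
    using ab t0 by (intro convexD[OF convex_X in_X]) auto
  also have "(a/t) *\<^sub>R (p + (1/a) *\<^sub>R v) + (b/t) *\<^sub>R (p + (1/b) *\<^sub>R w)
      = (a/t + b/t) *\<^sub>R p + (1/t) *\<^sub>R v + (1/t) *\<^sub>R w"
    using ab by (simp add: scaleR_add_right scaleR_add_left)
  also have "\<dots> = p + (1/t) *\<^sub>R (v + w)"
    unfolding \<open>a/t + b/t = 1\<close> by (simp add: scaleR_add_right)
  finally show "p + (1/t) *\<^sub>R (v + w) \<in> X" .
qed

lemma minkowski_le_norm: "minkowski v \<le> norm v / inradius"
proof (rule minkowski_leI)
  show "0 \<le> norm v / inradius" using inradius by simp
  fix t assume t: "norm v / inradius < t"
  then have "t > 0" using inradius by (meson divide_nonneg_pos le_less_trans norm_ge_zero)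
  moreover have "norm v < t * inradius" using t inradius by (simp add: pos_divide_less_eq)
  ultimately have "norm ((1/t) *\<^sub>R v) \<le> inradius" by (simp add: pos_divide_le_eq mult.commute)
  then show "p + (1/t) *\<^sub>R v \<in> X" by (rule add_in_X)
qed

lemma norm_le_minkowski: "norm v \<le> outradius * minkowski v"
proof -
  have "norm v \<le> outradius * t" if "minkowski v < t" for t
  proof -
    have "p + (1/t) *\<^sub>R v \<in> closure X" using minkowski_in_X[OF that] closure_subset by blast
    then have "norm ((1/t) *\<^sub>R v) \<le> outradius" using outradius by (auto simp: dist_norm)
    moreover have "t > 0" using that minkowski_nonneg[of v] by linarith
    ultimately show ?thesis by (simp add: pos_divide_le_eq mult.commute)
  qed
  then have "norm v / outradius \<le> t" if "minkowski v < t" for t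
    using that outradius(1) by (simp add: pos_divide_le_eq mult.commute)
  then have "norm v / outradius \<le> minkowski v" by (rule dense_ge)
  then show ?thesis using outradius(1) by (simp add: pos_divide_le_eq mult.commute)
qed

lemma minkowski_pos: "v \<noteq> 0 \<Longrightarrow> minkowski v > 0"
  using norm_le_minkowski[of v] minkowski_nonneg[of v] by (cases "minkowski v = 0") auto

lemma continuous_on_minkowski: "continuous_on A minkowski"
proof -
  have "(1/inradius)-lipschitz_on UNIV minkowski"
  proof (rule lipschitz_onI)
    have *: "minkowski v \<le> minkowski w + norm (v - w) / inradius" for v w
      using minkowski_triangle[of w "v - w"] minkowski_le_norm[of "v - w"] by simp
    show "dist (minkowski v) (minkowski w) \<le> 1 / inradius * dist v w" for v w
      using *[of v w] *[of w v] by (simp add: dist_norm norm_minus_commute abs_le_iff)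
    show "0 \<le> 1 / inradius" using inradius by simp
  qed
  then show ?thesis using lipschitz_on_continuous_on continuous_on_subset by blast
qed

lemma minkowski_le_1_iff: "minkowski (x - p) \<le> 1 \<longleftrightarrow> x \<in> closure X"
proof
  assume le: "minkowski (x - p) \<le> 1"
  have "p + (1/t) *\<^sub>R (x - p) \<in> closure X" if "t > 1" for t
    using minkowski_in_X[of "x - p" t] le that closure_subset by fastforce
  then have "eventually (\<lambda>n. p + (1 / (1 + 1 / real (Suc n))) *\<^sub>R (x - p) \<in> closure X) sequentially"
    by (intro always_eventually allI) simp
  moreover have "(\<lambda>n. p + (1 / (1 + 1 / real (Suc n))) *\<^sub>R (x - p)) \<longlonglongrightarrow> p + (1 / (1 + 0)) *\<^sub>R (x - p)"
    by (intro tendsto_intros LIMSEQ_Suc[OF lim_1_over_n, simplified] filterlim_compose[OF lim_1_over_n filterlim_Suc]) auto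
  ultimately have "p + (1 / (1 + 0)) *\<^sub>R (x - p) \<in> closure X"
    by (intro Lim_in_closed_set[of "closure X"]) auto
  then show "x \<in> closure X" by simp
next
  assume x: "x \<in> closure X"
  have "X \<subseteq> {x. minkowski (x - p) \<le> 1}" using minkowski_less_1_iff by (auto intro: less_imp_le)
  moreover have "closed {x. minkowski (x - p) \<le> 1}"
    by (intro closed_Collect_le continuous_on_compose2[OF continuous_on_minkowski[of UNIV]] continuous_intros) auto
  ultimately show "minkowski (x - p) \<le> 1" using x closure_minimal by blast
qed

text \<open>The exit point of the ray from \<open>p\<close> through \<open>x\<close> is the point where the Minkowski functional has
  the value 1.\<close>

lemma funk_minkowski:
  assumes x: "x \<in> X"
  shows "funk p x = - ln (1 - minkowski (x - p))"
proof -
  define g where "g = minkowski (x - p)"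
  have g: "0 \<le> g" "g < 1" using x minkowski_nonneg minkowski_less_1_iff by (auto simp: g_def)
  have iff: "funk p x \<le> L \<longleftrightarrow> - ln (1 - g) \<le> L" if L: "L > 0" for L
  proof -
    have e: "exp L > 1" using L by simp
    have "funk p x \<le> L \<longleftrightarrow> x + (1 / (exp L - 1)) *\<^sub>R (x - p) \<in> closure X"
      by (rule funk_le_iff[OF p_X x L])
    also have "\<dots> \<longleftrightarrow> minkowski (x + (1 / (exp L - 1)) *\<^sub>R (x - p) - p) \<le> 1"
      by (rule minkowski_le_1_iff[symmetric])
    also have "x + (1 / (exp L - 1)) *\<^sub>R (x - p) - p = (1 + 1 / (exp L - 1)) *\<^sub>R (x - p)"
      by (simp add: algebra_simps)
    also have "minkowski \<dots> = (1 + 1 / (exp L - 1)) * g"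
      unfolding g_def by (rule minkowski_scaleR) (use e in simp)
    also have "1 + 1 / (exp L - 1) = exp L / (exp L - 1)" using e by (simp add: field_simps)
    also have "exp L / (exp L - 1) * g \<le> 1 \<longleftrightarrow> exp L * g \<le> exp L - 1"
      using e by (simp add: pos_divide_le_eq)
    also have "\<dots> \<longleftrightarrow> exp (- L) \<le> 1 - g"
      by (simp add: exp_minus field_simps)
    also have "\<dots> \<longleftrightarrow> - L \<le> ln (1 - g)"
      using g by (simp add: ln_ge_iff)
    also have "\<dots> \<longleftrightarrow> - ln (1 - g) \<le> L" by auto
    finally show ?thesis .
  qed
  have nonneg: "0 \<le> funk p x" "0 \<le> - ln (1 - g)"
    using funk_nonneg[OF p_X x] g by auto
  have le1: "funk p x \<le> - ln (1 - g)"
    by (rule field_le_epsilon) (use iff nonneg in \<open>simp add: add_nonneg_pos\<close>)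
  have le2: "- ln (1 - g) \<le> funk p x"
    by (rule field_le_epsilon) (use iff nonneg in \<open>smt (verit)\<close>)
  show ?thesis using le1 le2 by (simp add: g_def)
qed

text \<open>The ray from \<open>x\<close> through \<open>p\<close> continues at least by \<open>inradius\<close> beyond \<open>p\<close>. So although \<open>funk p x\<close> is
  unbounded, the Funk distance back to \<open>p\<close> is bounded, and along a ray from \<open>p\<close> the Hilbert distance is
  the difference of \<open>funk p\<close> up to a constant.\<close>

lemma funk_to_centre: "x \<in> X \<Longrightarrow> funk x p \<le> ln (1 + outradius / inradius)"
proof -
  assume x: "x \<in> X"
  define L where "L = ln (1 + outradius / inradius)"
  have pos: "0 < outradius / inradius" using inradius outradius by simp
  then have L: "L > 0" by (simp add: L_def)
  have e: "exp L - 1 = outradius / inradius" using pos by (simp add: L_def)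
  have "norm (x - p) \<le> outradius" using x outradius(2) closure_subset[of X] by (auto simp: dist_norm norm_minus_commute)
  then have "norm ((1 / (exp L - 1)) *\<^sub>R (p - x)) \<le> inradius"
    unfolding e using inradius outradius by (simp add: norm_minus_commute pos_divide_le_eq mult.commute)
  then have "p + (1 / (exp L - 1)) *\<^sub>R (p - x) \<in> closure X" using add_in_X closure_subset by blast
  then show "funk x p \<le> ln (1 + outradius / inradius)"
    using funk_le_iff[OF x p_X L] by (simp add: L_def)
qed

lemma hilbert_dist_same_ray:
  assumes "x \<in> X" "y \<in> X" "x \<in> closed_segment p y"
  shows "hilbert_dist X x y \<le> funk p y - funk p x + ln (1 + outradius / inradius)"
proof -
  have "x \<in> closed_segment y p" using assms by (simp add: closed_segment_commute)
  then have "funk y p = funk y x + funk x p" using funk_segment[OF assms(2) p_X] by simp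
  then have "funk y x \<le> ln (1 + outradius / inradius)"
    using funk_to_centre[OF assms(2)] funk_nonneg[OF assms(1) p_X] by simp
  then show ?thesis using funk_segment[OF p_X assms(2,3)] by (simp add: hilbert_dist_funk assms)
qed

lemma hilbert_dist_same_ray':
  assumes x: "x \<in> X" and y: "y \<in> X" and eq: "a *\<^sub>R (x - p) = b *\<^sub>R (y - p)" "a \<ge> 0" "b > 0"
    and le: "\<bar>funk p x - funk p y\<bar> \<le> c"
  shows "hilbert_dist X x y \<le> c + ln (1 + outradius / inradius)"
proof (cases "a \<le> b")
  case True
  have "y - p = (a/b) *\<^sub>R (x - p)" using arg_cong[OF eq(1), of "\<lambda>v. (1/b) *\<^sub>R v"] eq(3) by simp
  then have "y = (1 - a/b) *\<^sub>R p + (a/b) *\<^sub>R x" by (simp add: algebra_simps)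
  then have "y \<in> closed_segment p x" unfolding in_segment using True eq by (intro exI[of _ "a/b"]) auto
  then show ?thesis using hilbert_dist_same_ray[OF y x] le by (simp add: H.commute)
next
  case False
  then have "a > 0" using eq by linarith
  then have "x - p = (b/a) *\<^sub>R (y - p)" using arg_cong[OF eq(1), of "\<lambda>v. (1/a) *\<^sub>R v"] \<open>a > 0\<close> by simp
  then have "x = (1 - b/a) *\<^sub>R p + (b/a) *\<^sub>R y" by (simp add: algebra_simps)
  then have "x \<in> closed_segment p y" unfolding in_segment using False eq \<open>a > 0\<close> by (intro exI[of _ "b/a"]) auto
  then show ?thesis using hilbert_dist_same_ray[OF x y] le by simp
qed

text \<open>The Minkowski functional of \<open>X\<close> need not be strictly convex, but adding a small multiple of the
  Euclidean norm produces a functional that has strictly convex balls: equality in the triangle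
  inequality of the norm forces \<open>v\<close> and \<open>w\<close> to have the same direction, and two such vectors with the
  same value are equal.\<close>

lemma open_segment_strict_minkowski:
  fixes e l :: real
  assumes e: "e > 0" and l: "l > 0"
    and v: "minkowski v + e * norm v \<le> l" and w: "minkowski w + e * norm w \<le> l" and "v \<noteq> w"
    and z: "z \<in> open_segment v w"
  shows "minkowski z + e * norm z < l"
proof -
  obtain t where t: "0 < t" "t < 1" "z = (1 - t) *\<^sub>R v + t *\<^sub>R w" using z unfolding in_segment by auto
  define N where "N v = minkowski v + e * norm v" for v
  have "minkowski z \<le> minkowski ((1 - t) *\<^sub>R v) + minkowski (t *\<^sub>R w)" unfolding t(3) by (rule minkowski_triangle)
  then have g: "minkowski z \<le> (1 - t) * minkowski v + t * minkowski w" using t by (simp add: minkowski_scaleR)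
  have n: "norm z \<le> (1 - t) * norm v + t * norm w"
    using norm_triangle_ineq[of "(1 - t) *\<^sub>R v" "t *\<^sub>R w"] t by simp
  then have "e * norm z \<le> e * ((1 - t) * norm v + t * norm w)" using e by (intro mult_left_mono) auto
  with g have Nz: "N z \<le> (1 - t) * N v + t * N w" by (simp add: N_def algebra_simps)
  have Nl: "N v \<le> l" "N w \<le> l" using v w by (auto simp: N_def)
  have "N z < l"
  proof (cases "N v = l \<and> N w = l")
    case False
    then have "l - N v > 0 \<or> l - N w > 0" using Nl by auto
    then have "0 < (1 - t) * (l - N v) + t * (l - N w)"
      using t Nl by (auto intro: add_pos_nonneg add_nonneg_pos)
    then show ?thesis using Nz by (simp add: algebra_simps)
  next
    case True
    have "norm z < (1 - t) * norm v + t * norm w"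
    proof (rule ccontr)
      assume "\<not> ?thesis"
      then have "norm ((1 - t) *\<^sub>R v + t *\<^sub>R w) = norm ((1 - t) *\<^sub>R v) + norm (t *\<^sub>R w)"
        using n t by simp
      then have "((1 - t) * norm v) *\<^sub>R t *\<^sub>R w = (t * norm w) *\<^sub>R (1 - t) *\<^sub>R v"
        using t norm_triangle_eq[of "(1 - t) *\<^sub>R v" "t *\<^sub>R w"] by (simp only: norm_scaleR) simp
      then have "(t * (1 - t)) *\<^sub>R (norm v *\<^sub>R w) = (t * (1 - t)) *\<^sub>R (norm w *\<^sub>R v)"
        by (simp add: mult_ac)
      then have "norm v *\<^sub>R w = norm w *\<^sub>R v \<or> t * (1 - t) = 0"
        by (simp only: scaleR_cancel_left)
      then have par: "norm v *\<^sub>R w = norm w *\<^sub>R v" using t by simp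
      have "v \<noteq> 0" using True l by (auto simp: N_def)
      define c where "c = norm w / norm v"
      have "w = c *\<^sub>R v"
      proof -
        have "norm v *\<^sub>R w = norm v *\<^sub>R (c *\<^sub>R v)" using par \<open>v \<noteq> 0\<close> by (simp add: c_def)
        then have "w = c *\<^sub>R v \<or> norm v = 0" by (simp only: scaleR_cancel_left)
        then show ?thesis using \<open>v \<noteq> 0\<close> by simp
      qed
      moreover have "c \<ge> 0" by (simp add: c_def)
      ultimately have "N w = c * N v" by (simp add: N_def minkowski_scaleR algebra_simps)
      then have "c = 1" using True l by simp
      then show False using \<open>w = c *\<^sub>R v\<close> \<open>v \<noteq> w\<close> by simp
    qed
    then have "e * norm z < e * ((1 - t) * norm v + t * norm w)" using e by simp
    with g have "N z < (1 - t) * N v + t * N w" by (simp add: N_def algebra_simps)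
    then show ?thesis using True by (simp add: algebra_simps)
  qed
  then show ?thesis by (simp add: N_def)
qed

end

section \<open>The upper bound\<close>

locale planar_convex_domain = pointed_convex_domain X p for X :: "(real ^ 2) set" and p
begin

text \<open>The band is projected radially from \<open>p\<close> to a strictly convex curve \<open>S\<close> on which \<open>funk p\<close> takes values
  between \<open>a\<close> and \<open>a + 1\<close>. Thus \<open>funk p\<close> changes by at most \<open>w + 1\<close> along the projection, and points
  move by at most \<open>c\<close>, which does not depend on \<open>a\<close>.\<close>

lemma two_coloured_band:
  assumes a: "a \<ge> 0" and w: "w > 0" and s: "s > 0"
    and c_def: "c = w + 1 + ln (1 + outradius / inradius)"
  shows "H.two_coloured s (13 * (s + 2 * c) + 2 * c) {x \<in> X. a \<le> funk p x \<and> funk p x < a + w}"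
proof -
  define b where "b = exp (- a - 1)"
  have b: "0 < b" "2 * b \<le> exp (- a)" "exp (- a) \<le> 1"
  proof -
    have "2 \<le> exp (1::real)" using exp_ge_add_one_self[of 1] by simp
    then have "2 * b \<le> exp 1 * b" by (simp add: b_def)
    also have "exp 1 * b = exp (- a)" by (simp add: b_def exp_add[symmetric])
    finally show "2 * b \<le> exp (- a)" .
  qed (use a in \<open>simp_all add: b_def\<close>)
  define l where "l = 1 - b"
  have l: "l > 0" "l < 1" unfolding l_def using b by linarith+
  \<comment> \<open>On \<open>X\<close> the perturbation \<open>e * norm (x - p)\<close> is at most \<open>b\<close>, so on \<open>S\<close> the Minkowski functional is between
    \<open>1 - 2 * b\<close> and \<open>1 - b\<close>.\<close>
  define e where "e = b / outradius"
  have e: "e > 0" using b outradius by (simp add: e_def)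
  define N where "N x = minkowski (x - p) + e * norm (x - p)" for x
  define C where "C = {x. N x < l}"
  define S where "S = {x. N x = l}"
  have SX: "S \<subseteq> X"
  proof
    fix x assume "x \<in> S"
    then have "minkowski (x - p) + e * norm (x - p) = l" by (simp add: S_def N_def)
    moreover have "0 \<le> e * norm (x - p)" using e by simp
    ultimately have "minkowski (x - p) < 1" using l by linarith
    then show "x \<in> X" using minkowski_less_1_iff by blast
  qed
  have seg: "open_segment v w \<subseteq> C" if vw: "v \<in> S \<union> C" "w \<in> S \<union> C" "v \<noteq> w" for v w
  proof
    fix z assume z: "z \<in> open_segment v w"
    have "z - p \<in> open_segment (v - p) (w - p)"
      using z open_segment_translation_eq[of "- p" z v w] by simp
    then show "z \<in> C"
      using open_segment_strict_minkowski[OF e l(1), of "v - p" "w - p" "z - p"] vw by (auto simp: S_def C_def N_def)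
  qed
  have oC: "open C" unfolding C_def N_def
    by (intro open_Collect_less continuous_intros continuous_on_compose2[OF continuous_on_minkowski[of UNIV]]) auto
  have cC: "convex C"
    unfolding convex_contains_open_segment
  proof (intro ballI)
    fix v w assume "v \<in> C" "w \<in> C"
    then show "open_segment v w \<subseteq> C" using seg[of v w] by (cases "v = w") auto
  qed
  have dC: "S \<inter> C = {}" by (auto simp: S_def C_def)
  have "0 < outradius / inradius" using inradius(1) outradius(1) by simp
  then have "0 \<le> ln (1 + outradius / inradius)" by simp
  then have "s + 2 * c > 0" using w s c_def by linarith
  then have "H.two_coloured (s + 2 * c) (13 * (s + 2 * c)) S"
    by (rule two_coloured_ordered_set[OF SX _ slope_order[OF oC cC dC seg]])
  moreover have "\<exists>y. y \<in> S \<and> hilbert_dist X x y \<le> c" if x: "x \<in> X" "a \<le> funk p x" "funk p x < a + w" for x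
  proof -
    obtain v where v: "v \<noteq> 0" "x = p \<or> v = x - p" using nonzero_Basis[where 'a = "real ^ 2"] nonempty_Basis by (metis ex_in_conv right_minus_eq)
    define g where "g = minkowski v + e * norm v"
    have g: "g > 0" using minkowski_nonneg[of v] e v by (simp add: g_def add_nonneg_pos)
    define y where "y = p + (l / g) *\<^sub>R v"
    have "(l / g) * g = (l / g) * minkowski v + (l / g) * (e * norm v)" by (subst (2) g_def) (rule distrib_left)
    then have "N y = (l / g) * g" using l g by (simp add: N_def y_def minkowski_scaleR mult.left_commute)
    then have yS: "y \<in> S" using g by (simp add: S_def)
    then have yX: "y \<in> X" using SX by blast
    have "e * norm (y - p) \<le> b"
    proof -
      have "norm (y - p) \<le> outradius" using yX outradius(2) closure_subset[of X] by (auto simp: dist_norm norm_minus_commute)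
      then have "e * norm (y - p) \<le> e * outradius" using e by simp
      then show ?thesis using outradius by (simp add: e_def)
    qed
    moreover have "0 \<le> e * norm (y - p)" using e by simp
    ultimately have "b \<le> 1 - minkowski (y - p)" "1 - minkowski (y - p) \<le> exp (- a)" "0 < 1 - minkowski (y - p)"
      using yS b by (auto simp: S_def N_def l_def)
    then have "ln b \<le> ln (1 - minkowski (y - p))" "ln (1 - minkowski (y - p)) \<le> ln (exp (- a))"
      using b(1) by (simp_all only: ln_le_cancel_iff exp_gt_zero)
    then have "a \<le> funk p y" "funk p y \<le> a + 1" unfolding funk_minkowski[OF yX] by (auto simp: b_def)
    then have "\<bar>funk p x - funk p y\<bar> \<le> w + 1" using x w by auto
    moreover obtain t where "t \<ge> 0" "t *\<^sub>R (y - p) = 1 *\<^sub>R (x - p)"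
    proof (cases "x = p")
      case True
      then show ?thesis using that[of 0] by simp
    next
      case False
      then show ?thesis using that[of "g / l"] v g l by (simp add: y_def)
    qed
    ultimately have "hilbert_dist X y x \<le> w + 1 + ln (1 + outradius / inradius)"
      using hilbert_dist_same_ray'[OF yX x(1), of t 1] by (simp add: abs_minus_commute)
    then show ?thesis using yS by (auto simp: c_def H.commute)
  qed
  then obtain h where h: "\<And>x. x \<in> {x \<in> X. a \<le> funk p x \<and> funk p x < a + w} \<Longrightarrow> h x \<in> S"
    "\<And>x. x \<in> {x \<in> X. a \<le> funk p x \<and> funk p x < a + w} \<Longrightarrow> hilbert_dist X x (h x) \<le> c"
    by (metis (mono_tags, lifting) mem_Collect_eq)
  ultimately show ?thesis
    by (intro two_coloured_vimage[OF H.Metric_space_axioms _ _ h SX]) auto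
qed

lemma asdim_le_2: "asdim_le X (hilbert_dist X) 2"
proof (rule H.asdim_le_2_bands)
  show "0 \<le> funk p x" if "x \<in> X" for x by (rule funk_nonneg[OF p_X that])
  show "funk p x \<le> funk p y + hilbert_dist X x y" if "x \<in> X" "y \<in> X" for x y
    using funk_triangle[OF p_X that(2,1)] funk_nonneg[OF that] by (simp add: hilbert_dist_funk that)
  fix w s :: real assume "w > 0" "s > 0"
  then show "\<exists>D. \<forall>a\<ge>0. H.two_coloured s D {x \<in> X. a \<le> funk p x \<and> funk p x < a + w}"
    using two_coloured_band[OF _ _ _ refl] by blast
qed

end

section \<open>A covering theorem for triangles\<close>

definition std_simplex :: "(real ^ 3) set" where
  "std_simplex = {b. (\<forall>i. 0 \<le> b $ i) \<and> (\<Sum>i\<in>UNIV. b $ i) = 1}"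

lemma std_simplex_le_1: "b \<in> std_simplex \<Longrightarrow> b $ i \<le> 1"
  unfolding std_simplex_def using member_le_sum[of i UNIV "\<lambda>i. b $ i"] by auto

lemma compact_std_simplex: "compact std_simplex"
proof -
  have "norm b \<le> 3" if "b \<in> std_simplex" for b
  proof -
    have "norm b \<le> (\<Sum>i\<in>UNIV. \<bar>b $ i\<bar>)" by (rule norm_le_l1_cart)
    also have "\<dots> \<le> (\<Sum>i\<in>(UNIV::3 set). 1)"
      using std_simplex_le_1[OF that] that by (intro sum_mono) (auto simp: std_simplex_def)
    finally show ?thesis by simp
  qed
  then have "bounded std_simplex" by (auto simp: bounded_iff)
  moreover have "closed std_simplex"
    unfolding std_simplex_def
    by (intro closed_Collect_conj closed_Collect_all closed_Collect_le closed_Collect_eq continuous_intros)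
  ultimately show ?thesis by (simp add: compact_eq_bounded_closed)
qed

lemma convex_std_simplex: "convex std_simplex"
proof (rule convexI)
  fix x y :: "real ^ 3" and u v :: real
  assume "x \<in> std_simplex" "y \<in> std_simplex" "0 \<le> u" "0 \<le> v" "u + v = 1"
  then show "u *\<^sub>R x + v *\<^sub>R y \<in> std_simplex"
    by (auto simp: std_simplex_def sum.distrib sum_distrib_left[symmetric])
qed

lemma std_simplex_nonempty: "std_simplex \<noteq> {}"
proof -
  have "(\<chi> i. 1/3) \<in> std_simplex" by (simp add: std_simplex_def)
  then show ?thesis by blast
qed

lemma three_cyclic: "j = i \<or> j = i - 1 \<or> j = i - 1 - 1" for i j :: 3
proof -
  have "\<forall>i j :: 3. j = i \<or> j = i - 1 \<or> j = i - 1 - 1" unfolding forall_3 by simp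
  then show ?thesis by blast
qed

lemma three_third:
  fixes i j :: 3
  assumes "i \<noteq> j"
  obtains k where "k \<noteq> i" "k \<noteq> j" "UNIV = {i, j, k}"
proof -
  \<comment> \<open>The three elements of the type \<open>3\<close> of residues modulo 3 add up to zero.\<close>
  have "\<forall>i j :: 3. i \<noteq> j \<longrightarrow> - i - j \<noteq> i \<and> - i - j \<noteq> j \<and> (\<forall>l. l = i \<or> l = j \<or> l = - i - j)"
    unfolding forall_3 by simp
  then have "- i - j \<noteq> i" "- i - j \<noteq> j" "UNIV = {i, j, - i - j}" using assms by blast+
  with that show thesis by blast
qed

context Metric_space
begin

text \<open>Colour each member of the cover by a side that it keeps away from, and let \<open>\<phi> i x\<close> measure how far
  \<open>x\<close> is inside the \<open>r\<close>-neighbourhood of the members of colour \<open>i\<close>. If no point were close to members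
  of all three colours, normalizing would map the simplex to its boundary and each side into itself.
  Following this map by a rotation of the coordinates gives a map without fixed point, against
  Brouwer's theorem.\<close>

lemma lebesgue_covering_triangle:
  fixes \<psi> :: "real ^ 3 \<Rightarrow> 'a"
  assumes M: "\<And>b. b \<in> std_simplex \<Longrightarrow> \<psi> b \<in> M"
    and cont: "\<And>b. b \<in> std_simplex \<Longrightarrow> ((\<lambda>b'. d (\<psi> b) (\<psi> b')) \<longlongrightarrow> 0) (at b within std_simplex)"
    and cover: "\<Union>\<U> = M"
    and miss: "\<And>U. U \<in> \<U> \<Longrightarrow> \<exists>i. \<forall>b\<in>std_simplex. b $ i = 0 \<longrightarrow> (\<forall>y\<in>U. r \<le> d (\<psi> b) y)"
    and r: "r > 0"
  shows "\<exists>b\<in>std_simplex. \<exists>U :: 3 \<Rightarrow> 'a set. inj U \<and> (\<forall>i. U i \<in> \<U> \<and> U i \<inter> mcball (\<psi> b) r \<noteq> {})"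
proof (rule ccontr)
  assume none: "\<not> ?thesis"
  obtain col :: "'a set \<Rightarrow> 3" where col: "\<And>U b y. U \<in> \<U> \<Longrightarrow> b \<in> std_simplex \<Longrightarrow> b $ col U = 0 \<Longrightarrow> y \<in> U \<Longrightarrow> r \<le> d (\<psi> b) y"
    using miss by metis
  define C where "C i = \<Union>{U \<in> \<U>. col U = i}" for i
  have CM: "C i \<subseteq> M" for i using cover by (auto simp: C_def)
  \<comment> \<open>The inserted \<open>0\<close> truncates negative values and covers the case that no set has colour \<open>i\<close>.\<close>
  define \<phi> where "\<phi> i x = Sup (insert 0 ((\<lambda>y. r - d x y) ` C i))" for i x
  have bdd: "bdd_above (insert 0 ((\<lambda>y. r - d x y) ` C i))" for i x
    by (rule bdd_aboveI[of _ r]) (use r nonneg in \<open>auto simp: \<close>)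
  have \<phi>0: "0 \<le> \<phi> i x" for i x unfolding \<phi>_def by (rule cSup_upper[OF _ bdd]) simp
  have \<phi>_ge: "r - d x y \<le> \<phi> i x" if "y \<in> C i" for i x y
    unfolding \<phi>_def by (rule cSup_upper[OF _ bdd]) (use that in simp)
  have \<phi>_le: "\<phi> i x \<le> c" if "0 \<le> c" "\<And>y. y \<in> C i \<Longrightarrow> r - d x y \<le> c" for i x c
    unfolding \<phi>_def by (rule cSup_least) (use that in auto)
  have lip: "\<phi> i x \<le> \<phi> i y + d x y" if "x \<in> M" "y \<in> M" for i x y
  proof (rule \<phi>_le)
    show "0 \<le> \<phi> i y + d x y" using \<phi>0[of i y] nonneg[of x y] by simp
    fix z assume z: "z \<in> C i"
    then show "r - d x z \<le> \<phi> i y + d x y"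
      using \<phi>_ge[OF z, of y] triangle[of y x z] that CM[of i] commute[of x y] by fastforce
  qed
  have lip': "\<bar>\<phi> i y - \<phi> i x\<bar> \<le> d x y" if "x \<in> M" "y \<in> M" for i x y
    using lip[OF that, of i] lip[OF that(2,1), of i] commute[of x y] by (simp add: abs_le_iff)
  have \<phi>_cont: "continuous_on std_simplex (\<lambda>b. \<phi> i (\<psi> b))" for i
    unfolding continuous_on_def
  proof
    fix b assume b: "b \<in> std_simplex"
    have "((\<lambda>b'. \<phi> i (\<psi> b') - \<phi> i (\<psi> b)) \<longlongrightarrow> 0) (at b within std_simplex)"
    proof (rule Lim_null_comparison[OF _ cont[OF b]])
      show "\<forall>\<^sub>F b' in at b within std_simplex. norm (\<phi> i (\<psi> b') - \<phi> i (\<psi> b)) \<le> d (\<psi> b) (\<psi> b')"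
        unfolding eventually_at_filter
        by (rule always_eventually) (use lip' M b in auto)
    qed
    then show "((\<lambda>b'. \<phi> i (\<psi> b')) \<longlongrightarrow> \<phi> i (\<psi> b)) (at b within std_simplex)" by (simp add: LIM_zero_iff)
  qed
  have side: "\<phi> i (\<psi> b) = 0" if "b \<in> std_simplex" "b $ i = 0" for i b
  proof -
    have "r \<le> d (\<psi> b) y" if "y \<in> C i" for y
      using that col[of _ b y] \<open>b \<in> std_simplex\<close> \<open>b $ i = 0\<close> by (auto simp: C_def)
    then have "\<phi> i (\<psi> b) \<le> 0" by (intro \<phi>_le) auto
    then show ?thesis using \<phi>0[of i "\<psi> b"] by simp
  qed
  define s where "s b = (\<Sum>i\<in>UNIV. \<phi> i (\<psi> b))" for b
  have s: "s b > 0" if b: "b \<in> std_simplex" for b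
  proof -
    obtain U where U: "U \<in> \<U>" "\<psi> b \<in> U" using M[OF b] cover by blast
    then have "\<psi> b \<in> C (col U)" by (auto simp: C_def)
    from \<phi>_ge[OF this, of "\<psi> b"] have "r \<le> \<phi> (col U) (\<psi> b)" using M[OF b] by simp
    also have "\<dots> \<le> s b" unfolding s_def by (rule member_le_sum) (use \<phi>0 in auto)
    finally show ?thesis using r by simp
  qed
  have zero: "\<exists>i. \<phi> i (\<psi> b) = 0" if b: "b \<in> std_simplex" for b
  proof (rule ccontr)
    assume "\<not> ?thesis"
    then have pos: "0 < \<phi> i (\<psi> b)" for i using \<phi>0[of i "\<psi> b"] by (metis order_less_le)
    have "\<exists>U. U \<in> \<U> \<and> col U = i \<and> U \<inter> mcball (\<psi> b) r \<noteq> {}" for i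
    proof -
      have "\<exists>y\<in>C i. d (\<psi> b) y < r"
      proof (rule ccontr)
        assume "\<not> ?thesis"
        then have "\<phi> i (\<psi> b) \<le> 0" by (intro \<phi>_le) (auto simp: not_less)
        then show False using pos[of i] by simp
      qed
      then obtain y where y: "y \<in> C i" "d (\<psi> b) y < r" by blast
      then obtain U where U: "U \<in> \<U>" "col U = i" "y \<in> U" by (auto simp: C_def)
      moreover have "y \<in> mcball (\<psi> b) r" using y M[OF b] CM by auto
      ultimately show ?thesis by blast
    qed
    then obtain U where U: "\<And>i. U i \<in> \<U> \<and> col (U i) = i \<and> U i \<inter> mcball (\<psi> b) r \<noteq> {}" by metis
    then have "inj U" by (metis injI)
    with U b none show False by blast
  qed
  \<comment> \<open>At a fixed point, \<open>\<phi> i = 0\<close> means that coordinate \<open>i - 1\<close> vanishes, and then \<open>\<phi> (i - 1) = 0\<close>.\<close>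
  define g where "g b = (\<chi> i. \<phi> (i + 1) (\<psi> b) / s b)" for b
  have "\<exists>b\<in>std_simplex. g b = b"
  proof (rule brouwer[OF compact_std_simplex convex_std_simplex std_simplex_nonempty])
    show "continuous_on std_simplex g"
      unfolding g_def s_def
      by (intro continuous_intros continuous_on_vec_lambda \<phi>_cont) (use s in \<open>fastforce simp: s_def\<close>)
    show "g \<in> std_simplex \<rightarrow> std_simplex"
    proof
      fix b assume b: "b \<in> std_simplex"
      have "(\<Sum>i\<in>UNIV. \<phi> (i + 1) (\<psi> b)) = s b"
        unfolding s_def by (rule sum.reindex_bij_witness[of _ "\<lambda>i. i - 1" "\<lambda>i. i + 1"]) auto
      then have "(\<Sum>i\<in>UNIV. \<phi> (i + 1) (\<psi> b) / s b) = 1"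
        using s[OF b] by (simp add: sum_divide_distrib[symmetric])
      then show "g b \<in> std_simplex" using s[OF b] \<phi>0 by (simp add: std_simplex_def g_def)
    qed
  qed blast
  then obtain b where b: "b \<in> std_simplex" "g b = b" by blast
  have next_zero: "\<phi> (i - 1) (\<psi> b) = 0" if "\<phi> i (\<psi> b) = 0" for i
  proof -
    have "b $ (i - 1) = g b $ (i - 1)" using b by simp
    also have "\<dots> = 0" using that by (simp add: g_def)
    finally show ?thesis using side b by blast
  qed
  obtain i where "\<phi> i (\<psi> b) = 0" using zero b by blast
  then have "\<phi> j (\<psi> b) = 0" for j using three_cyclic[of j i] next_zero by metis
  then have "s b = 0" by (simp add: s_def)
  with s b show False by force
qed

text \<open>In a cover by sets of diameter at most \<open>D\<close>, no member can come within distance 1 of all three sides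
  of a triangle for which no three points, one on each side, are pairwise within \<open>D + 2\<close>. So three
  members meet some ball of radius 1, for every such cover.\<close>

lemma not_asdim_le_1I:
  assumes "\<And>L. L > 0 \<Longrightarrow> \<exists>\<psi> :: real ^ 3 \<Rightarrow> 'a. (\<forall>b\<in>std_simplex. \<psi> b \<in> M) \<and>
      (\<forall>b\<in>std_simplex. ((\<lambda>b'. d (\<psi> b) (\<psi> b')) \<longlongrightarrow> 0) (at b within std_simplex)) \<and>
      \<not> (\<exists>B :: 3 \<Rightarrow> real ^ 3. (\<forall>i. B i \<in> std_simplex \<and> B i $ i = 0) \<and> (\<forall>i j. d (\<psi> (B i)) (\<psi> (B j)) \<le> L))"
  shows "\<not> asdim_le M d 1"
proof
  assume "asdim_le M d 1"
  then obtain \<U> where \<U>: "\<U> \<subseteq> Pow M" "\<Union>\<U> = M" "uniformly_bounded d \<U>" "r_multiplicity M d 1 \<U> \<le> enat (1 + 1)"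
    unfolding asdim_le_def by (meson zero_less_one)
  obtain D where D: "\<And>U x y. U \<in> \<U> \<Longrightarrow> x \<in> U \<Longrightarrow> y \<in> U \<Longrightarrow> d x y \<le> D"
    using \<U>(3) unfolding uniformly_bounded_def by blast
  define L where "L = max D 0 + 2"
  have "L > 0" by (simp add: L_def)
  from assms[OF this] obtain \<psi> :: "real ^ 3 \<Rightarrow> 'a" where \<psi>: "\<And>b. b \<in> std_simplex \<Longrightarrow> \<psi> b \<in> M"
    "\<And>b. b \<in> std_simplex \<Longrightarrow> ((\<lambda>b'. d (\<psi> b) (\<psi> b')) \<longlongrightarrow> 0) (at b within std_simplex)"
    and far: "\<And>B. \<lbrakk>\<And>i. B i \<in> std_simplex \<and> B i $ i = 0; \<And>i j. d (\<psi> (B i)) (\<psi> (B j)) \<le> L\<rbrakk> \<Longrightarrow> False"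
    by blast
  have "\<exists>i. \<forall>b\<in>std_simplex. b $ i = 0 \<longrightarrow> (\<forall>y\<in>U. 1 \<le> d (\<psi> b) y)" if U: "U \<in> \<U>" for U
  proof (rule ccontr)
    assume "\<not> ?thesis"
    then have "\<forall>i. \<exists>b y. b \<in> std_simplex \<and> b $ i = 0 \<and> y \<in> U \<and> d (\<psi> b) y < 1" by (meson not_le)
    then obtain B y where B: "\<And>i. B i \<in> std_simplex" "\<And>i. B i $ i = 0" "\<And>i. y i \<in> U" "\<And>i. d (\<psi> (B i)) (y i) < 1"
      by metis
    have "d (\<psi> (B i)) (\<psi> (B j)) \<le> L" for i j
    proof -
      have in_M: "\<psi> (B i) \<in> M" "\<psi> (B j) \<in> M" "y i \<in> M" "y j \<in> M" using \<psi>(1) B U \<U>(1) by blast+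
      have "d (\<psi> (B i)) (\<psi> (B j)) \<le> d (\<psi> (B i)) (y i) + d (y i) (\<psi> (B j))" by (rule triangle) fact+
      also have "d (y i) (\<psi> (B j)) \<le> d (y i) (y j) + d (y j) (\<psi> (B j))" by (rule triangle) fact+
      finally show ?thesis using B(4)[of i] B(4)[of j] D[OF U B(3) B(3), of i j]
        by (simp add: L_def commute[of "y j"])
    qed
    with B(1,2) far show False by blast
  qed
  from lebesgue_covering_triangle[OF \<psi> \<U>(2) this zero_less_one]
  obtain b U where b: "b \<in> std_simplex" and U: "inj (U :: 3 \<Rightarrow> 'a set)" "\<And>i. U i \<in> \<U>" "\<And>i. U i \<inter> mcball (\<psi> b) 1 \<noteq> {}"
    by blast
  define S where "S = {enat k | k. \<forall>x\<in>M. finite {U\<in>\<U>. U \<inter> mcball x 1 \<noteq> {}} \<and> card {U\<in>\<U>. U \<inter> mcball x 1 \<noteq> {}} \<le> k}"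
  have "Inf S \<le> enat 2" using \<U>(4) by (simp add: r_multiplicity_def S_def numeral_2_eq_2)
  then have "Inf S < enat 3" by (rule le_less_trans) simp
  then obtain k where k: "k < 3" "\<forall>x\<in>M. finite {U\<in>\<U>. U \<inter> mcball x 1 \<noteq> {}} \<and> card {U\<in>\<U>. U \<inter> mcball x 1 \<noteq> {}} \<le> k"
    unfolding Inf_less_iff S_def by auto
  let ?hit = "{U\<in>\<U>. U \<inter> mcball (\<psi> b) 1 \<noteq> {}}"
  have "range U \<subseteq> ?hit" using U by blast
  moreover have hit: "finite ?hit" "card ?hit \<le> k" using k(2) \<psi>(1)[OF b] by blast+
  ultimately have "card (range U) \<le> k" by (meson card_mono le_trans)
  moreover have "card (range U) = 3" using card_image[OF U(1)] by simp
  ultimately show False using k(1) by simp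
qed

end

section \<open>The lower bound\<close>

lemma parallel_of_orthogonal_real2:
  fixes n v :: "real ^ 2"
  assumes "n \<noteq> 0" "n \<bullet> v = 0"
  shows "\<exists>c. v = c *\<^sub>R (\<chi> i. if i = 1 then - (n $ 2) else n $ 1)"
proof -
  have nv: "n $ 1 * v $ 1 + n $ 2 * v $ 2 = 0" using assms(2) by (simp add: inner_vec_def sum_2)
  show ?thesis
  proof (cases "n $ 1 = 0")
    case True
    then have "n $ 2 \<noteq> 0" using assms(1) by (auto simp: vec_eq_iff forall_2)
    then show ?thesis using nv True
      by (intro exI[of _ "- v $ 1 / n $ 2"]) (simp add: vec_eq_iff forall_2)
  next
    case False
    then have "v $ 1 = - (n $ 2 * v $ 2) / n $ 1" using nv by (simp add: field_simps)
    then show ?thesis using False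
      by (intro exI[of _ "v $ 2 / n $ 1"]) (simp add: vec_eq_iff forall_2)
  qed
qed

text \<open>Affine independence is stated for the coefficients, so that barycentric coordinates are unique by
  \<open>bary_eqD\<close>.\<close>

locale extreme_triangle =
  fixes K :: "(real ^ 2) set" and A :: "3 \<Rightarrow> real ^ 2"
  assumes convex_K: "convex K"
    and A: "\<And>i. A i extreme_point_of K"
    and indep: "\<And>c :: real ^ 3. (\<Sum>i\<in>UNIV. c $ i) = 0 \<Longrightarrow> (\<Sum>i\<in>UNIV. c $ i *\<^sub>R A i) = 0 \<Longrightarrow> c = 0"
begin

definition bary :: "real ^ 3 \<Rightarrow> real ^ 2" where "bary c = (\<Sum>i\<in>UNIV. c $ i *\<^sub>R A i)"

lemma A_K: "A i \<in> K"
  using A by (simp add: extreme_point_of_def)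

lemma bary_eqD:
  assumes "bary c = bary c'" "(\<Sum>i\<in>UNIV. c $ i) = (\<Sum>i\<in>UNIV. c' $ i)"
  shows "c = c'"
proof -
  have "c - c' = 0"
    by (rule indep) (use assms in \<open>simp_all add: bary_def sum_subtractf scaleR_diff_left\<close>)
  then show ?thesis by simp
qed

text \<open>When two coordinates of a point of \<open>K\<close> are nonpositive, the third vertex is a convex combination of
  this point and of the two other vertices; being extreme, it is the point itself.\<close>

lemma two_nonpos_vertex:
  assumes c: "(\<Sum>i\<in>UNIV. c $ i) = 1" "bary c \<in> K" and le: "c $ i \<le> 0" "c $ j \<le> 0" and "i \<noteq> j"
  shows "\<exists>k. bary c = A k"
proof -
  obtain k where k: "k \<noteq> i" "k \<noteq> j" "UNIV = {i, j, k}" using three_third[OF \<open>i \<noteq> j\<close>] .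
  have sum3: "(\<Sum>l\<in>UNIV. f l) = f i + f j + f k" for f :: "3 \<Rightarrow> 'b::comm_monoid_add"
    unfolding k(3) using k(1,2) \<open>i \<noteq> j\<close> by (simp add: add.assoc eq_commute)
  have s: "c $ i + c $ j + c $ k = 1" using c(1) by (simp add: sum3)
  have q: "bary c = c $ i *\<^sub>R A i + c $ j *\<^sub>R A j + c $ k *\<^sub>R A k" by (simp add: bary_def sum3)
  show ?thesis
  proof (cases "c $ k = 1")
    case True
    then have "c $ i = 0" "c $ j = 0" using s le by linarith+
    then show ?thesis using q True by (intro exI[of _ k]) simp
  next
    case False
    then have m: "c $ k > 1" using s le by linarith
    define a where "a = - c $ i / (c $ k - 1)"
    define b where "b = - c $ j / (c $ k - 1)"
    have ab: "0 \<le> a" "0 \<le> b" using le m by (simp_all add: a_def b_def divide_nonpos_pos)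
    have ab1: "a + b = 1"
    proof -
      have "a + b = (- c $ i - c $ j) / (c $ k - 1)" by (simp add: a_def b_def diff_divide_distrib)
      also have "- c $ i - c $ j = c $ k - 1" using s by linarith
      finally show ?thesis using m by simp
    qed
    define y where "y = a *\<^sub>R A i + b *\<^sub>R A j"
    have y: "y \<in> K" unfolding y_def by (rule convexD[OF convex_K A_K A_K ab ab1])
    have "(c $ k - 1) *\<^sub>R y = - (c $ i *\<^sub>R A i) - c $ j *\<^sub>R A j"
    proof -
      have "(c $ k - 1) * a = - c $ i" "(c $ k - 1) * b = - c $ j" using m by (simp_all add: a_def b_def)
      then show ?thesis by (simp add: y_def scaleR_add_right)
    qed
    then have "bary c + (c $ k - 1) *\<^sub>R y = c $ k *\<^sub>R A k" by (simp add: q)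
    then have "(1 / c $ k) *\<^sub>R (bary c + (c $ k - 1) *\<^sub>R y) = A k" using m by simp
    moreover have "(1 / c $ k) * (c $ k - 1) = 1 - 1 / c $ k" using m by (simp add: field_simps)
    ultimately have Ak: "A k = (1 - 1 / c $ k) *\<^sub>R y + (1 / c $ k) *\<^sub>R bary c"
      by (simp add: scaleR_add_right add.commute)
    have "bary c = A k"
    proof (rule ccontr)
      assume ne: "bary c \<noteq> A k"
      have "y \<noteq> bary c"
      proof
        assume "y = bary c"
        then have "A k = bary c" using Ak by (simp add: scaleR_add_left[symmetric])
        with ne show False by simp
      qed
      then have "A k \<in> open_segment y (bary c)"
        unfolding in_segment using Ak m by (intro conjI exI[of _ "1 / c $ k"]) auto
      then show False using A[of k] y c(2) by (auto simp: extreme_point_of_def)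
    qed
    then show ?thesis by blast
  qed
qed

text \<open>An extreme point cannot be in the interior of a segment of \<open>K\<close> that starts at \<open>q\<close>.\<close>

lemma extensible_not_vertex:
  assumes "q \<in> K" "\<kappa> > 0" "A k + \<kappa> *\<^sub>R (A k - q) \<in> K"
  shows "q = A k"
proof (rule ccontr)
  assume ne: "q \<noteq> A k"
  define z where "z = A k + \<kappa> *\<^sub>R (A k - q)"
  define t where "t = 1 / (1 + \<kappa>)"
  have t: "0 < t" "t < 1" using assms by (simp_all add: t_def)
  have "(1 + \<kappa>) *\<^sub>R A k = \<kappa> *\<^sub>R q + z" by (simp add: z_def algebra_simps)
  then have "t *\<^sub>R (1 + \<kappa>) *\<^sub>R A k = t *\<^sub>R (\<kappa> *\<^sub>R q + z)" by simp
  moreover have "t * (1 + \<kappa>) = 1" "t * \<kappa> = 1 - t" using assms by (simp_all add: t_def field_simps)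
  ultimately have Ak: "A k = (1 - t) *\<^sub>R q + t *\<^sub>R z" by (simp add: scaleR_add_right)
  have "q \<noteq> z"
  proof
    assume "q = z"
    then have "A k = q" using Ak by (simp add: scaleR_add_left[symmetric])
    with ne show False by simp
  qed
  then have "A k \<in> open_segment q z" unfolding in_segment using Ak t by blast
  then show False using A[of k] assms by (auto simp: extreme_point_of_def z_def)
qed

text \<open>The point \<open>q i\<close> is on or beyond the side opposite to the vertex \<open>A i\<close>, any two of the points can be
  prolonged in \<open>K\<close> beyond both ends, and \<open>q 1\<close> is on a supporting line. Prolonging shows that all three
  are on that line, so one of them, \<open>q j\<close>, is between the two others. Its \<open>j\<close>-th coordinate is
  nonpositive, hence so is that of one of the neighbours, which then has two nonpositive coordinates and
  is a vertex; but a vertex cannot be prolonged unless all three points coincide, and then all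
  coordinates of their common position would be nonpositive.\<close>

lemma no_common_face:
  fixes c :: "3 \<Rightarrow> real ^ 3"
  defines "q \<equiv> \<lambda>i. bary (c i)"
  assumes c1: "\<And>i. (\<Sum>k\<in>UNIV. c i $ k) = 1" and K: "\<And>i. q i \<in> K" and diag: "\<And>i. c i $ i \<le> 0"
    and \<kappa>: "\<kappa> > 0" and ext: "\<And>i j. q i + \<kappa> *\<^sub>R (q i - q j) \<in> K"
    and n: "n \<noteq> 0" "\<And>x. x \<in> K \<Longrightarrow> n \<bullet> x \<le> n \<bullet> q 1"
  shows False
proof -
  have off: False if ij: "i \<noteq> j" "c i $ j \<le> 0" for i j
  proof -
    obtain l where l: "q i = A l" using two_nonpos_vertex[OF c1 _ diag ij(2,1)] K by (auto simp: q_def)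
    have "q m = q i" for m
      using extensible_not_vertex[OF K \<kappa>, of l m] ext[of i m] by (simp add: l)
    then have "c m = c i" for m using bary_eqD[of "c m" "c i"] c1 by (simp add: q_def)
    then have "c i $ m \<le> 0" for m using diag[of m] by metis
    then have "(\<Sum>k\<in>UNIV. c i $ k) \<le> 0" by (simp add: sum_nonpos)
    then show False using c1[of i] by simp
  qed
  have mid: False if seg: "q j \<in> closed_segment (q i) (q k)" and ne: "i \<noteq> j" "k \<noteq> j" for i j k
  proof -
    obtain s where s: "0 \<le> s" "s \<le> 1" "q j = (1 - s) *\<^sub>R q i + s *\<^sub>R q k"
      using seg unfolding in_segment by blast
    have "c j = (1 - s) *\<^sub>R c i + s *\<^sub>R c k"
    proof (rule bary_eqD)
      show "bary (c j) = bary ((1 - s) *\<^sub>R c i + s *\<^sub>R c k)"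
        using s(3) by (simp add: q_def bary_def sum.distrib scaleR_add_left scaleR_sum_right)
      show "(\<Sum>l\<in>UNIV. c j $ l) = (\<Sum>l\<in>UNIV. ((1 - s) *\<^sub>R c i + s *\<^sub>R c k) $ l)"
        using c1 by (simp add: sum.distrib sum_distrib_left[symmetric])
    qed
    then have cj: "c j $ j = (1 - s) * c i $ j + s * c k $ j" by simp
    have "c i $ j > 0" "c k $ j > 0" using off ne by (meson not_le)+
    then have "c j $ j > 0" unfolding cj
      using s by (cases "s = 0") (auto intro: add_nonneg_pos)
    then show False using diag[of j] by simp
  qed
  have same: "n \<bullet> (q i - q j) = 0" for i j
  proof -
    have eq: "n \<bullet> q i = n \<bullet> q 1" for i
    proof (rule antisym)
      show "n \<bullet> q i \<le> n \<bullet> q 1" using n(2) K by blast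
      have "n \<bullet> (q 1 + \<kappa> *\<^sub>R (q 1 - q i)) \<le> n \<bullet> q 1" using n(2) ext by blast
      then have "\<kappa> * (n \<bullet> q 1 - n \<bullet> q i) \<le> 0" by (simp add: inner_add_right inner_diff_right)
      then show "n \<bullet> q 1 \<le> n \<bullet> q i" using \<kappa> by (simp add: mult_le_0_iff)
    qed
    show ?thesis using eq[of i] eq[of j] by (simp add: inner_diff_right)
  qed
  have "collinear {q 1, q 2, q 3}"
    unfolding collinear_def
  proof (rule exI[of _ "\<chi> i. if i = 1 then - (n $ 2) else n $ 1"], intro ballI)
    fix x y assume "x \<in> {q 1, q 2, q 3}" "y \<in> {q 1, q 2, q 3}"
    then have "n \<bullet> (x - y) = 0" using same by auto
    from parallel_of_orthogonal_real2[OF n(1) this]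
    show "\<exists>c. x - y = c *\<^sub>R (\<chi> i. if i = 1 then - (n $ 2) else n $ 1)" .
  qed
  then have "between (q 2, q 3) (q 1) \<or> between (q 3, q 1) (q 2) \<or> between (q 1, q 2) (q 3)"
    by (simp add: collinear_between_cases)
  then show False
    using mid[of 1 2 3] mid[of 2 3 1] mid[of 3 1 2] by (auto simp: between_mem_segment)
qed

end

lemma (in convex_domain) hilbert_dist_continuous:
  assumes x: "x \<in> X" and f: "(f \<longlongrightarrow> x) F"
  shows "((\<lambda>a. hilbert_dist X x (f a)) \<longlongrightarrow> 0) F"
proof (rule tendstoI)
  fix e :: real assume e: "e > 0"
  obtain r where r: "r > 0" "cball x r \<subseteq> X" using open_X x open_contains_cball by blast
  define \<rho> where "\<rho> = r / 2"
  define L where "L = e / 3"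
  have L: "L > 0" "exp L > 1" using e by (simp_all add: L_def)
  define \<delta> where "\<delta> = min \<rho> (\<rho> * (exp L - 1))"
  have \<delta>: "\<delta> > 0" using r L by (simp add: \<delta>_def \<rho>_def)
  have small: "dist (hilbert_dist X x y) 0 < e" if y: "dist y x < \<delta>" for y
  proof -
    have near: "z \<in> X" if "dist z x \<le> 2 * \<rho>" for z using r that by (auto simp: \<rho>_def dist_commute)
    have yX: "y \<in> X" using y r by (intro near) (simp add: \<delta>_def \<rho>_def)
    have funk_small: "funk u v \<le> L" if "u \<in> X" "v \<in> X" "dist v x \<le> \<rho>" "dist u v \<le> \<rho> * (exp L - 1)" for u v
    proof -
      have "norm ((1 / (exp L - 1)) *\<^sub>R (v - u)) \<le> \<rho>"
        using that(4) L by (simp add: dist_norm norm_minus_commute pos_divide_le_eq mult.commute)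
      then have "dist (v + (1 / (exp L - 1)) *\<^sub>R (v - u)) x \<le> 2 * \<rho>"
        using that(3) dist_triangle[of "v + (1 / (exp L - 1)) *\<^sub>R (v - u)" x v] by (simp add: dist_norm)
      then have "v + (1 / (exp L - 1)) *\<^sub>R (v - u) \<in> closure X" using near closure_subset by blast
      then show ?thesis using funk_le_iff[OF that(1,2) L(1)] by simp
    qed
    have "funk x y \<le> L" "funk y x \<le> L"
      using y r by (auto intro!: funk_small x yX simp: \<delta>_def \<rho>_def dist_commute)
    then have "hilbert_dist X x y \<le> 2 * L" using x yX by (simp add: hilbert_dist_funk)
    also have "\<dots> < e" using e by (simp add: L_def)
    finally show ?thesis using H.nonneg[of x y] by simp
  qed
  have "\<forall>\<^sub>F a in F. dist (f a) x < \<delta>" using tendstoD[OF f \<delta>] .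
  then show "\<forall>\<^sub>F a in F. dist (hilbert_dist X x (f a)) 0 < e"
    by (rule eventually_mono) (rule small)
qed

text \<open>By the Krein-Milman theorem the extreme points span the plane affinely, so three of them form an
  affine basis; its centroid is an interior point of the closure.\<close>

lemma exists_extreme_triangle:
  fixes X :: "(real ^ 2) set"
  assumes "X \<noteq> {}" "open X" "convex X" "bounded X"
  obtains A :: "3 \<Rightarrow> real ^ 2" where "extreme_triangle (closure X) A" "(1/3) *\<^sub>R (\<Sum>i\<in>UNIV. A i) \<in> X"
proof -
  let ?E = "{x. x extreme_point_of closure X}"
  have hull: "closure X = convex hull ?E"
    using assms by (intro Krein_Milman_Minkowski) (auto simp: convex_closure)
  have "affine hull ?E = UNIV"
  proof -
    have "UNIV = affine hull X" using affine_hull_open assms by metis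
    also have "\<dots> \<subseteq> affine hull (closure X)" by (intro hull_mono closure_subset)
    also have "\<dots> = affine hull ?E" by (subst hull) (rule affine_hull_convex_hull)
    finally show ?thesis by blast
  qed
  then obtain B where B: "\<not> affine_dependent B" "B \<subseteq> ?E" "affine hull B = UNIV"
    using affine_basis_exists[of ?E] by metis
  have fin: "finite B" using aff_independent_finite[OF B(1)] .
  have "int (card B) = aff_dim (affine hull B) + 1"
    using aff_dim_affine_independent[OF B(1)] by simp
  then have card: "card B = 3" using B(3) by simp
  then obtain A :: "3 \<Rightarrow> real ^ 2" where A: "bij_betw A UNIV B"
    using finite_same_card_bij[of "UNIV :: 3 set" B] fin by auto
  then have inj: "inj A" and ran: "range A = B" by (auto simp: bij_betw_def)
  have "extreme_triangle (closure X) A"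
  proof
    show "convex (closure X)" using assms by (simp add: convex_closure)
    show "A i extreme_point_of closure X" for i using B(2) ran by blast
    fix c :: "real ^ 3" assume c: "(\<Sum>i\<in>UNIV. c $ i) = 0" "(\<Sum>i\<in>UNIV. c $ i *\<^sub>R A i) = 0"
    define U where "U v = c $ (inv A v)" for v
    have UA: "U (A i) = c $ i" for i using inj by (simp add: U_def)
    have "sum U B = 0" using sum.reindex_bij_betw[OF A, of U] c(1) by (simp add: UA)
    moreover have "(\<Sum>v\<in>B. U v *\<^sub>R v) = 0"
      using sum.reindex_bij_betw[OF A, of "\<lambda>v. U v *\<^sub>R v"] c(2) by (simp add: UA)
    ultimately have "\<forall>v\<in>B. U v = 0" using B(1) unfolding affine_dependent_explicit_finite[OF fin] by blast
    moreover have "A i \<in> B" for i using ran by blast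
    ultimately have "c $ i = 0" for i using UA[of i] by metis
    then show "c = 0" by (simp add: vec_eq_iff)
  qed
  moreover have "(1/3) *\<^sub>R (\<Sum>i\<in>UNIV. A i) \<in> X"
  proof -
    have s: "(\<Sum>i\<in>UNIV. A i) = (\<Sum>v\<in>B. v)" using sum.reindex_bij_betw[OF A, of "\<lambda>v. v"] .
    have "\<exists>u. (\<forall>x\<in>B. 0 < u x \<and> u x < 1) \<and> sum u B = 1 \<and> (\<Sum>x\<in>B. u x *\<^sub>R x) = (1/3) *\<^sub>R (\<Sum>i\<in>UNIV. A i)"
      by (rule exI[of _ "\<lambda>_. 1/3"]) (simp add: card s scaleR_sum_right)
    then have "(1/3) *\<^sub>R (\<Sum>i\<in>UNIV. A i) \<in> interior (convex hull B)"
      using interior_convex_hull_explicit[OF B(1)] card by simp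
    also have "\<dots> \<subseteq> interior (closure X)"
      by (rule interior_mono) (subst hull, rule hull_mono[OF B(2)])
    also have "\<dots> = X" using assms by (simp add: convex_interior_closure interior_open)
    finally show ?thesis .
  qed
  ultimately show thesis using that by blast
qed

lemma compact_simplex_triples: "compact {B :: (real ^ 3) ^ 3. \<forall>i. B $ i \<in> std_simplex \<and> B $ i $ i = 0}"
proof -
  let ?S = "{B :: (real ^ 3) ^ 3. \<forall>i. B $ i \<in> std_simplex \<and> B $ i $ i = 0}"
  obtain r where r: "\<And>b. b \<in> std_simplex \<Longrightarrow> norm b \<le> r"
    using compact_imp_bounded[OF compact_std_simplex] unfolding bounded_iff by blast
  have "norm B \<le> 3 * r" if "B \<in> ?S" for B
  proof -
    have "norm B \<le> (\<Sum>i\<in>UNIV. norm (B $ i))" unfolding norm_vec_def by (rule L2_set_le_sum) simp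
    also have "\<dots> \<le> (\<Sum>i\<in>(UNIV :: 3 set). r)" by (rule sum_mono) (use r that in blast)
    finally show ?thesis by simp
  qed
  then have "bounded ?S" unfolding bounded_iff by blast
  moreover have "closed ?S"
    unfolding std_simplex_def mem_Collect_eq
    by (intro closed_Collect_conj closed_Collect_all closed_Collect_le closed_Collect_eq continuous_intros)
  ultimately show ?thesis by (simp add: compact_eq_bounded_closed)
qed

locale centred_triangle = planar_convex_domain X p + extreme_triangle "closure X" A for X p A +
  assumes centroid: "p = (1/3) *\<^sub>R (\<Sum>i\<in>UNIV. A i)"
begin

definition dir :: "real ^ 3 \<Rightarrow> real ^ 2" where "dir b = (\<Sum>i\<in>UNIV. b $ i *\<^sub>R (A i - p))"

text \<open>On the ray in direction \<open>dir b\<close>, at which the Minkowski functional has the value \<open>g\<close>, the blown-up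
  point has the value \<open>t * g / (1 + t * g)\<close>. So \<open>blowup t\<close> maps continuously into \<open>X\<close>, and as \<open>t\<close>
  grows, it moves everything but the centre towards the boundary.\<close>

definition blowup :: "real \<Rightarrow> real ^ 3 \<Rightarrow> real ^ 2" where
  "blowup t b = p + (t / (1 + t * minkowski (dir b))) *\<^sub>R dir b"

lemma continuous_on_dir: "continuous_on S dir"
  unfolding dir_def by (intro continuous_intros)

lemma p_bary: "p = (\<Sum>i\<in>UNIV. (1/3) *\<^sub>R A i)"
  by (simp add: centroid scaleR_sum_right)

text \<open>The centre \<open>p\<close> has the coordinates \<open>1/3\<close>; scaling by \<open>m\<close> from \<open>p\<close> acts on coordinates accordingly. For
  \<open>m \<ge> 1\<close>, a vanishing coordinate of \<open>b\<close> becomes nonpositive.\<close>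

lemma p_plus_dir:
  assumes "b \<in> std_simplex"
  shows "p + m *\<^sub>R dir b = bary (\<chi> k. m * b $ k + (1 - m) / 3)"
proof -
  have "dir b = (\<Sum>i\<in>UNIV. b $ i *\<^sub>R A i) - (\<Sum>i\<in>UNIV. b $ i) *\<^sub>R p"
    by (simp add: dir_def scaleR_diff_right sum_subtractf scaleR_sum_left)
  then have d: "dir b = (\<Sum>i\<in>UNIV. b $ i *\<^sub>R A i) - p" using assms by (simp add: std_simplex_def)
  have "p + m *\<^sub>R dir b = m *\<^sub>R (\<Sum>i\<in>UNIV. b $ i *\<^sub>R A i) + (1 - m) *\<^sub>R p"
    by (simp add: d algebra_simps)
  also have "\<dots> = (\<Sum>i\<in>UNIV. (m * b $ i) *\<^sub>R A i) + (\<Sum>i\<in>UNIV. ((1 - m) / 3) *\<^sub>R A i)"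
    by (subst p_bary) (simp add: scaleR_sum_right)
  also have "\<dots> = bary (\<chi> k. m * b $ k + (1 - m) / 3)"
    by (simp add: bary_def sum.distrib[symmetric] scaleR_add_left)
  finally show ?thesis .
qed

lemma minkowski_dir_le_1:
  assumes "b \<in> std_simplex"
  shows "minkowski (dir b) \<le> 1"
proof -
  have b: "\<And>i. 0 \<le> b $ i" "(\<Sum>i\<in>UNIV. b $ i) = 1" using assms by (auto simp: std_simplex_def)
  have "p + dir b = bary b" using p_plus_dir[OF assms, of 1] by simp
  also have "\<dots> \<in> closure X" unfolding bary_def
    by (rule convex_sum) (use b A_K convex_K in auto)
  finally show ?thesis using minkowski_le_1_iff[of "p + dir b"] by simp
qed

lemma dir_nonzero:
  assumes "b \<in> std_simplex" "b $ i = 0"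
  shows "dir b \<noteq> 0"
proof
  assume "dir b = 0"
  then have "bary (\<chi> k. 1 * b $ k + (1 - 1) / 3) = bary (\<chi> k. 0 * b $ k + (1 - 0) / 3)"
    using p_plus_dir[OF assms(1), of 1] p_plus_dir[OF assms(1), of 0] by simp
  then have "bary b = bary (\<chi> k. 1 / 3)" by simp
  then have "b = (\<chi> k. 1 / 3)"
    by (rule bary_eqD) (use assms in \<open>simp add: std_simplex_def\<close>)
  with assms(2) show False by simp
qed

lemma blowup_in_X:
  assumes "t \<ge> 0"
  shows "blowup t b \<in> X"
proof -
  define g where "g = minkowski (dir b)"
  have g: "0 \<le> t * g" using minkowski_nonneg assms by (simp add: g_def)
  have "minkowski (blowup t b - p) = t / (1 + t * g) * g"
    using assms g by (simp add: blowup_def g_def minkowski_scaleR)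
  also have "\<dots> < 1" using g by (simp add: pos_divide_less_eq add_pos_nonneg)
  finally show ?thesis using minkowski_less_1_iff by blast
qed

lemma continuous_on_blowup:
  assumes "t \<ge> 0"
  shows "continuous_on S (blowup t)"
proof -
  have "1 + t * minkowski (dir b) \<noteq> 0" for b
    using minkowski_nonneg[of "dir b"] assms by (smt (verit) mult_nonneg_nonneg)
  then show ?thesis
    unfolding blowup_def
    by (intro continuous_intros continuous_on_dir continuous_on_compose2[OF continuous_on_minkowski[of UNIV]]) auto
qed

text \<open>Otherwise, for \<open>t\<close> tending to infinity, there would be points on the three sides at mutual distance at
  most \<open>L\<close>. By compactness they converge to points \<open>q i\<close> of the boundary, and the linear form of
  \<open>funk \<le> L\<close> passes to the limit, where it says that the segment from \<open>q i\<close> to \<open>q j\<close> can be prolonged.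
  A supporting line at \<open>q 1\<close> then contradicts \<open>no_common_face\<close>.\<close>

lemma sides_far_apart:
  assumes L: "L > 0"
  shows "\<exists>t>0. \<not> (\<exists>B :: 3 \<Rightarrow> real ^ 3. (\<forall>i. B i \<in> std_simplex \<and> B i $ i = 0) \<and>
    (\<forall>i j. hilbert_dist X (blowup t (B i)) (blowup t (B j)) \<le> L))"
proof (rule ccontr)
  let ?S = "{B :: (real ^ 3) ^ 3. \<forall>i. B $ i \<in> std_simplex \<and> B $ i $ i = 0}"
  define t where "t n = real (Suc n)" for n
  assume "\<not> ?thesis"
  then have "\<forall>n. \<exists>B :: 3 \<Rightarrow> real ^ 3. (\<forall>i. B i \<in> std_simplex \<and> B i $ i = 0) \<and>
    (\<forall>i j. hilbert_dist X (blowup (t n) (B i)) (blowup (t n) (B j)) \<le> L)"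
    by (auto simp: t_def)
  then obtain B0 :: "nat \<Rightarrow> 3 \<Rightarrow> real ^ 3" where B0: "\<And>n i. B0 n i \<in> std_simplex" "\<And>n i. B0 n i $ i = 0"
    "\<And>n i j. hilbert_dist X (blowup (t n) (B0 n i)) (blowup (t n) (B0 n j)) \<le> L"
    by metis
  define B :: "nat \<Rightarrow> (real ^ 3) ^ 3" where "B n = (\<chi> i. B0 n i)" for n
  have "B n \<in> ?S" for n using B0 by (simp add: B_def)
  then have "\<exists>l\<in>?S. \<exists>r :: nat \<Rightarrow> nat. strict_mono r \<and> (B \<circ> r) \<longlonglongrightarrow> l"
    by (intro compact_simplex_triples[unfolded compact_def, rule_format]) auto
  then obtain l and r :: "nat \<Rightarrow> nat" where l: "l \<in> ?S" and r: "strict_mono r" and lim: "(B \<circ> r) \<longlonglongrightarrow> l"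
    by blast
  define g where "g i = minkowski (dir (l $ i))" for i
  have lS: "l $ i \<in> std_simplex" "l $ i $ i = 0" for i using l by auto
  have g: "0 < g i" "g i \<le> 1" for i
    using minkowski_pos[OF dir_nonzero[OF lS]] minkowski_dir_le_1[OF lS(1)] by (simp_all add: g_def)
  define q where "q i = p + (1 / g i) *\<^sub>R dir (l $ i)" for i
  define y where "y n i = blowup (t (r n)) (B0 (r n) i)" for n i
  have ylim: "(\<lambda>n. y n i) \<longlonglongrightarrow> q i" for i
  proof -
    have Bi: "(\<lambda>n. B0 (r n) i) \<longlonglongrightarrow> l $ i"
      using tendsto_vec_nth[OF lim, of i] by (simp add: B_def o_def)
    have d: "(\<lambda>n. dir (B0 (r n) i)) \<longlonglongrightarrow> dir (l $ i)"
      using continuous_on_tendsto_compose[OF continuous_on_dir[of UNIV] Bi] by simp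
    have ga: "(\<lambda>n. minkowski (dir (B0 (r n) i))) \<longlonglongrightarrow> g i"
      using continuous_on_tendsto_compose[OF continuous_on_minkowski[of UNIV] d] by (simp add: g_def)
    have "(\<lambda>n. 1 / t n) \<longlonglongrightarrow> 0" unfolding t_def using LIMSEQ_inverse_real_of_nat by (simp add: inverse_eq_divide)
    from LIMSEQ_subseq_LIMSEQ[OF this r] have ti: "(\<lambda>n. 1 / t (r n)) \<longlonglongrightarrow> 0" by (simp add: o_def)
    have "(\<lambda>n. p + (1 / (1 / t (r n) + minkowski (dir (B0 (r n) i)))) *\<^sub>R dir (B0 (r n) i))
        \<longlonglongrightarrow> p + (1 / (0 + g i)) *\<^sub>R dir (l $ i)"
      by (intro tendsto_intros ti ga d) (use g[of i] in simp)
    moreover have "p + (1 / (1 / t (r n) + minkowski (dir (B0 (r n) i)))) *\<^sub>R dir (B0 (r n) i) = y n i" for n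
    proof -
      have "t (r n) > 0" by (simp add: t_def)
      then have "1 / (1 / t (r n) + minkowski (dir (B0 (r n) i))) = t (r n) / (1 + t (r n) * minkowski (dir (B0 (r n) i)))"
        by (simp add: divide_simps mult.commute)
      then show ?thesis by (simp add: y_def blowup_def)
    qed
    ultimately show ?thesis by (simp add: q_def)
  qed
  define \<kappa> where "\<kappa> = 1 / (exp L - 1)"
  have \<kappa>: "\<kappa> > 0" using L by (simp add: \<kappa>_def)
  have yX: "y n i \<in> X" for n i by (simp add: y_def t_def blowup_in_X)
  have ext: "q j + \<kappa> *\<^sub>R (q j - q i) \<in> closure X" for i j
  proof (rule Lim_in_closed_set[OF closed_closure])
    show "(\<lambda>n. y n j + \<kappa> *\<^sub>R (y n j - y n i)) \<longlonglongrightarrow> q j + \<kappa> *\<^sub>R (q j - q i)"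
      by (intro tendsto_intros ylim)
    have "funk (y n i) (y n j) \<le> L" for n
      using B0(3)[of "r n" i j] funk_nonneg[OF yX[of n j] yX[of n i]] hilbert_dist_funk[OF yX[of n i] yX[of n j]]
      by (simp add: y_def)
    then have "y n j + \<kappa> *\<^sub>R (y n j - y n i) \<in> closure X" for n
      using funk_le_iff[OF yX yX L] by (simp add: \<kappa>_def)
    then show "\<forall>\<^sub>F n in sequentially. y n j + \<kappa> *\<^sub>R (y n j - y n i) \<in> closure X" by simp
  qed simp
  have gq: "minkowski (q i - p) = 1" for i
    using g[of i] by (simp add: q_def minkowski_scaleR g_def[symmetric])
  have qK: "q i \<in> closure X" and qX: "q i \<notin> X" for i
    using gq[of i] minkowski_le_1_iff[of "q i"] minkowski_less_1_iff[of "q i"] by auto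
  obtain n where n: "n \<noteq> 0" "\<forall>x\<in>X. n \<bullet> x \<le> n \<bullet> q 1"
  proof -
    obtain n b where nb: "n \<noteq> 0" "\<forall>x\<in>X. n \<bullet> x \<le> b" "\<forall>x\<in>{q 1}. n \<bullet> x \<ge> b"
      using separating_hyperplane_sets[of X "{q 1}"] convex_X p_X qX[of 1] by auto
    then show thesis using that[of n] by fastforce
  qed
  have "closure X \<subseteq> {x. n \<bullet> x \<le> n \<bullet> q 1}"
    using n(2) by (intro closure_minimal closed_halfspace_le) auto
  then have sup: "n \<bullet> x \<le> n \<bullet> q 1" if "x \<in> closure X" for x using that by blast
  define c where "c i = (\<chi> k. (1 / g i) * l $ i $ k + (1 - 1 / g i) / 3)" for i
  have qc: "q i = bary (c i)" for i unfolding q_def c_def by (rule p_plus_dir[OF lS(1)])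
  have c1: "(\<Sum>k\<in>UNIV. c i $ k) = 1" for i
  proof -
    have "(\<Sum>k\<in>UNIV. m * l $ i $ k + (1 - m) / 3) = 1" for m
    proof -
      have "(\<Sum>k\<in>UNIV. m * l $ i $ k + (1 - m) / 3) = m * (\<Sum>k\<in>UNIV. l $ i $ k) + (1 - m)"
        by (simp add: sum.distrib sum_distrib_left)
      then show ?thesis using lS(1)[of i] by (simp add: std_simplex_def)
    qed
    from this[of "1 / g i"] show ?thesis by (simp only: c_def vec_lambda_beta)
  qed
  have diag: "c i $ i \<le> 0" for i using lS(2)[of i] g[of i] by (simp add: c_def)
  show False
    by (rule no_common_face[OF c1 _ diag \<kappa> _ n(1)]) (use qK ext sup in \<open>simp_all add: qc[symmetric]\<close>)
qed

lemma not_asdim_le_1: "\<not> asdim_le X (hilbert_dist X) 1"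
proof (rule H.not_asdim_le_1I)
  fix L :: real assume "L > 0"
  from sides_far_apart[OF this] obtain t where t: "t > 0"
    "\<not> (\<exists>B :: 3 \<Rightarrow> real ^ 3. (\<forall>i. B i \<in> std_simplex \<and> B i $ i = 0) \<and>
      (\<forall>i j. hilbert_dist X (blowup t (B i)) (blowup t (B j)) \<le> L))" by blast
  have "((\<lambda>b'. hilbert_dist X (blowup t b) (blowup t b')) \<longlongrightarrow> 0) (at b within std_simplex)"
    if "b \<in> std_simplex" for b
  proof (rule hilbert_dist_continuous)
    show "blowup t b \<in> X" using t(1) by (simp add: blowup_in_X)
    show "(blowup t \<longlongrightarrow> blowup t b) (at b within std_simplex)"
      using continuous_on_blowup[of t std_simplex] t(1) that unfolding continuous_on_def by simp
  qed
  then show "\<exists>\<psi> :: real ^ 3 \<Rightarrow> real ^ 2. (\<forall>b\<in>std_simplex. \<psi> b \<in> X) \<and>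
      (\<forall>b\<in>std_simplex. ((\<lambda>b'. hilbert_dist X (\<psi> b) (\<psi> b')) \<longlongrightarrow> 0) (at b within std_simplex)) \<and>
      \<not> (\<exists>B :: 3 \<Rightarrow> real ^ 3. (\<forall>i. B i \<in> std_simplex \<and> B i $ i = 0) \<and>
          (\<forall>i j. hilbert_dist X (\<psi> (B i)) (\<psi> (B j)) \<le> L))"
    using t blowup_in_X[of t] by (intro exI[of _ "blowup t"] conjI ballI) simp_all
qed

end

theorem theorem1p5:
  fixes X :: "(real ^ 2) set"
  assumes "X \<noteq> {}" and "open X" and "convex X" and "bounded X"
  shows "has_asdim X (hilbert_dist X) 2"
proof -
  from exists_extreme_triangle[OF assms] obtain A :: "3 \<Rightarrow> real ^ 2"
    where tri: "extreme_triangle (closure X) A" "(1/3) *\<^sub>R (\<Sum>i\<in>UNIV. A i) \<in> X" .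
  interpret extreme_triangle "closure X" A by (rule tri(1))
  interpret centred_triangle X "(1/3) *\<^sub>R (\<Sum>i\<in>UNIV. A i)" A
    by unfold_locales (use assms tri(2) in auto)
  show ?thesis unfolding has_asdim_def using asdim_le_2 not_asdim_le_1 by simp
qed

end
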